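(* Let $G$ be a $3$-connected split graph with at least $13$ vertices that is $\{K_{1,4},K_{1,4}+e\}$-free. Then $G$ is Hamilton-connected, i.e., for every pair of distinct vertices $u,v\in V(G)$ there is a path in $G$ with endpoints $u$ and $v$ that contains every vertex of $G$.
   Context: All graphs are finite, simple and connected. A connected graph $G$ is a split graph if its vertex set can be partitioned into a clique and an independent set (either possibly empty). A graph is $\{F_1,\dots,F_k\}$-free if it contains no induced subgraph isomorphic to any $F_i$. $K_{1,4}$ is the star with four leaves, and $K_{1,4}+e$ is the graph obtained from $K_{1,4}$ by adding one edge joining two nonadjacent vertices (i.e., joining two leaves). *)

theory Defs
  imports "Graph_Theory.Graph_Theory"
begin

text \<open>
  Finite simple graphs are the \<^locale>\<open>pair_graph\<close>s: an edge between \<open>u\<close> and \<open>v\<close> is the pair of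
  opposite arcs \<open>(u, v)\<close> and \<open>(v, u)\<close>.
\<close>

definition clique :: "'a pair_pre_digraph \<Rightarrow> 'a set \<Rightarrow> bool" where
  "clique G C \<longleftrightarrow> C \<subseteq> pverts G \<and> (\<forall>u\<in>C. \<forall>v\<in>C. u \<noteq> v \<longrightarrow> (u, v) \<in> parcs G)"

definition independent_set :: "'a pair_pre_digraph \<Rightarrow> 'a set \<Rightarrow> bool" where
  "independent_set G I \<longleftrightarrow> I \<subseteq> pverts G \<and> (\<forall>u\<in>I. \<forall>v\<in>I. (u, v) \<notin> parcs G)"

definition split_graph :: "'a pair_pre_digraph \<Rightarrow> bool" where
  "split_graph G \<longleftrightarrow> Digraph_Component.connected (with_proj G) \<and>
    (\<exists>C I. pverts G = C \<union> I \<and> C \<inter> I = {} \<and> clique G C \<and> independent_set G I)"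

definition k_connected :: "nat \<Rightarrow> 'a pair_pre_digraph \<Rightarrow> bool" where
  "k_connected k G \<longleftrightarrow> card (pverts G) > k \<and>
    (\<forall>S. S \<subseteq> pverts G \<and> card S < k \<longrightarrow>
      Digraph_Component.connected (with_proj G \<restriction> (pverts G - S)))"

definition induced_free :: "'b pair_pre_digraph set \<Rightarrow> 'a pair_pre_digraph \<Rightarrow> bool" where
  "induced_free \<F> G \<longleftrightarrow>
    \<not> (\<exists>F\<in>\<F>. \<exists>H. induced_subgraph H (with_proj G) \<and> digraph_iso H (with_proj F))"

definition K14 :: "nat pair_pre_digraph" where
  "K14 = \<lparr> pverts = {0, 1, 2, 3, 4}, parcs = {0} \<times> {1, 2, 3, 4} \<union> {1, 2, 3, 4} \<times> {0} \<rparr>"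

definition K14_plus_e :: "nat pair_pre_digraph" where
  "K14_plus_e = \<lparr> pverts = pverts K14, parcs = parcs K14 \<union> {(1, 2), (2, 1)} \<rparr>"

definition hamilton_connected :: "'a pair_pre_digraph \<Rightarrow> bool" where
  "hamilton_connected G \<longleftrightarrow> (\<forall>u\<in>pverts G. \<forall>v\<in>pverts G. u \<noteq> v \<longrightarrow>
    (\<exists>p. pre_digraph.apath (with_proj G) u p v \<and>
      set (pre_digraph.awalk_verts (with_proj G) u p) = pverts G))"

lemma K14_complete_bipartite: "complete_bipartite_digraph 1 4 (with_proj K14)"
  unfolding complete_bipartite_digraph_pair_def
proof (intro conjI exI)
  show "card {0::nat} = 1" "card {1, 2, 3, 4::nat} = 4" by simp_all
qed (auto simp: K14_def)

lemma pair_graph_K14_plus_e: "pair_graph K14_plus_e"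
  by unfold_locales (auto simp: K14_plus_e_def K14_def symmetric_def sym_def)

end

theory Submission
  imports Defs
begin

text \<open>
  Write the graph as a clique \<open>C\<close> plus an independent set \<open>I\<close>. Hamiltonian paths between clique
  vertices suffice: an independent vertex can be deleted from such a path, since its neighbours on the
  path are in \<open>C\<close>, and reattached at an end. For \<open>u, v \<in> C\<close> start with the paths \<open>[u, v]\<close> and \<open>[c]\<close>
  for the other \<open>c \<in> C\<close>, and use each \<open>a \<in> I\<close> to join the ends of two different paths. Three
  neighbours of \<open>a\<close> that are still ends of paths always allow this, because a path has only two ends.
  If the neighbourhoods are pairwise disjoint, at most one clique vertex is lost as an end. Otherwise,
  freeness from the two stars gives: two intersecting neighbourhoods miss at most one vertex of \<open>C\<close>;
  a clique vertex has at most three neighbours in \<open>I\<close>; and if it has three, every clique vertex is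
  adjacent to two of them. Hence, when \<open>card I \<ge> 4\<close>, all neighbourhoods but those of one or two
  hubs are disjoint, or \<open>card I = 4\<close> with large degrees, and the greedy joining succeeds if the vertices
  of large degree are treated last.
\<close>

section \<open>Systems of disjoint paths with ends in a clique\<close>

locale finite_clique =
  fixes adj :: "'a \<Rightarrow> 'a \<Rightarrow> bool" and C :: "'a set"
  assumes adj_sym: "adj x y \<Longrightarrow> adj y x"
    and finite_C: "finite C"
    and adj_C: "\<lbrakk>x \<in> C; y \<in> C; x \<noteq> y\<rbrakk> \<Longrightarrow> adj x y"
begin

definition nbrs :: "'a \<Rightarrow> 'a set" where
  "nbrs a = {c \<in> C. adj a c}"

text \<open>Both ends lie in \<open>C\<close>, so two disjoint pieces can always be linked by a
  clique edge.\<close>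

definition piece :: "'a list \<Rightarrow> bool" where
  "piece xs \<longleftrightarrow> xs \<noteq> [] \<and> distinct xs \<and> successively adj xs \<and> hd xs \<in> C \<and> last xs \<in> C"

text \<open>
  The two vertices \<open>u\<close> and \<open>v\<close> to be joined by a Hamiltonian path stay consecutive in one of the
  paths: cutting that path between them at the very end makes them the two endpoints.
\<close>

definition path_system :: "'a \<Rightarrow> 'a \<Rightarrow> 'a list set \<Rightarrow> 'a set \<Rightarrow> bool" where
  "path_system u v PS W \<longleftrightarrow> finite PS \<and> (\<forall>P\<in>PS. piece P) \<and>
    (\<forall>P\<in>PS. \<forall>Q\<in>PS. P \<noteq> Q \<longrightarrow> set P \<inter> set Q = {}) \<and> \<Union>(set ` PS) = W \<and>
    (\<exists>P\<in>PS. \<exists>X Y. P = X @ [u, v] @ Y \<or> P = X @ [v, u] @ Y)"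

definition ends :: "'a list set \<Rightarrow> 'a set" where
  "ends PS = (\<Union>P\<in>PS. {hd P, last P})"

text \<open>A vertex that is a whole path by itself is still an end after being joined on one side,
  so these vertices are counted separately.\<close>

definition singles :: "'a list set \<Rightarrow> 'a set" where
  "singles PS = {c. [c] \<in> PS}"

lemma nbrs_subset: "nbrs a \<subseteq> C"
  by (auto simp: nbrs_def)

lemma finite_nbrs: "finite (nbrs a)"
  using finite_C nbrs_subset by (rule finite_subset[rotated])

lemma piece_rev: "piece P \<Longrightarrow> piece (rev P)"
  by (auto simp: piece_def hd_rev last_rev intro: successively_mono[of adj] adj_sym)

lemma piece_ending_at:
  assumes "piece P" "p \<in> {hd P, last P}"
  obtains P' where "piece P'" "P' = P \<or> P' = rev P" "last P' = p"
proof (cases "p = last P")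
  case True
  with assms(1) show ?thesis by (intro that[of P]) auto
next
  case False
  with assms show ?thesis
    by (intro that[of "rev P"]) (auto simp: piece_rev last_rev)
qed

lemma piece_starting_at:
  assumes "piece P" "p \<in> {hd P, last P}"
  obtains P' where "piece P'" "P' = P \<or> P' = rev P" "hd P' = p"
proof (cases "p = hd P")
  case True
  with assms(1) show ?thesis by (intro that[of P]) auto
next
  case False
  with assms show ?thesis
    by (intro that[of "rev P"]) (auto simp: piece_rev hd_rev)
qed

lemma piece_join:
  assumes "piece P" "piece Q" "set P \<inter> set Q = {}" "distinct M"
    "set M \<inter> (set P \<union> set Q) = {}" "successively adj (last P # M @ [hd Q])"
  shows "piece (P @ M @ Q)"
proof -
  have "successively adj (P @ M @ Q)"
    using assms(1,2,6)
    by (cases "M = []") (auto simp: piece_def successively_append_iff successively_Cons)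
  then show ?thesis
    using assms(1-5) by (auto simp: piece_def)
qed

lemma consecutive_rev:
  assumes "\<exists>X Y. P = X @ [u, v] @ Y \<or> P = X @ [v, u] @ Y"
  shows "\<exists>X Y. rev P = X @ [u, v] @ Y \<or> rev P = X @ [v, u] @ Y"
proof -
  obtain X Y where "P = X @ [u, v] @ Y \<or> P = X @ [v, u] @ Y"
    using assms by blast
  then have "rev P = rev Y @ [u, v] @ rev X \<or> rev P = rev Y @ [v, u] @ rev X"
    by auto
  then show ?thesis by blast
qed

lemma consecutive_append:
  assumes "(\<exists>X Y. P = X @ [u, v] @ Y \<or> P = X @ [v, u] @ Y) \<or>
    (\<exists>X Y. Q = X @ [u, v] @ Y \<or> Q = X @ [v, u] @ Y)"
  shows "\<exists>X Y. P @ M @ Q = X @ [u, v] @ Y \<or> P @ M @ Q = X @ [v, u] @ Y"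
  using assms
proof
  assume "\<exists>X Y. P = X @ [u, v] @ Y \<or> P = X @ [v, u] @ Y"
  then obtain X Y where "P = X @ [u, v] @ Y \<or> P = X @ [v, u] @ Y" by blast
  then have "P @ M @ Q = X @ [u, v] @ (Y @ M @ Q) \<or> P @ M @ Q = X @ [v, u] @ (Y @ M @ Q)"
    by auto
  then show ?thesis by blast
next
  assume "\<exists>X Y. Q = X @ [u, v] @ Y \<or> Q = X @ [v, u] @ Y"
  then obtain X Y where "Q = X @ [u, v] @ Y \<or> Q = X @ [v, u] @ Y" by blast
  then have "P @ M @ Q = (P @ M @ X) @ [u, v] @ Y \<or> P @ M @ Q = (P @ M @ X) @ [v, u] @ Y"
    by auto
  then show ?thesis by blast
qed

text \<open>In the applications \<open>M\<close> is empty (a clique edge) or one independent vertex.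
  Only \<open>p\<close> and \<open>q\<close> can be buried inside the new path, and not when they
  formed a path alone.\<close>

lemma path_system_merge:
  assumes PS: "path_system u v PS W"
    and PQ: "P \<in> PS" "Q \<in> PS" "P \<noteq> Q"
    and p: "p \<in> {hd P, last P}" and q: "q \<in> {hd Q, last Q}"
    and M: "distinct M" "set M \<inter> W = {}" "successively adj (p # M @ [q])"
  obtains PS' where "path_system u v PS' (W \<union> set M)" "card PS = Suc (card PS')"
    "ends PS - ({p, q} - singles PS) \<subseteq> ends PS'" "singles PS - {p, q} \<subseteq> singles PS'"
proof -
  have fin: "finite PS" and pieces: "\<And>R. R \<in> PS \<Longrightarrow> piece R"
    and disj: "\<And>R S. R \<in> PS \<Longrightarrow> S \<in> PS \<Longrightarrow> R \<noteq> S \<Longrightarrow> set R \<inter> set S = {}"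
    and W: "\<Union>(set ` PS) = W"
    and cons: "\<exists>P\<in>PS. \<exists>X Y. P = X @ [u, v] @ Y \<or> P = X @ [v, u] @ Y"
    using PS unfolding path_system_def by blast+
  obtain P' where P': "piece P'" "P' = P \<or> P' = rev P" "last P' = p"
    using piece_ending_at[OF pieces[OF PQ(1)] p] by blast
  obtain Q' where Q': "piece Q'" "Q' = Q \<or> Q' = rev Q" "hd Q' = q"
    using piece_starting_at[OF pieces[OF PQ(2)] q] by blast
  have sets: "set P' = set P" "set Q' = set Q"
    using P' Q' by auto
  have ne: "P \<noteq> []" "Q \<noteq> []" "P' \<noteq> []" "Q' \<noteq> []"
    using pieces PQ P' Q' by (auto simp: piece_def)
  define R where "R = P' @ M @ Q'"
  have PW: "set P \<subseteq> W" "set Q \<subseteq> W"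
    using W PQ by auto
  have R: "piece R"
    unfolding R_def
    using P' Q' M PW disj[OF PQ] sets by (intro piece_join) auto
  have setR: "set R = set P \<union> set M \<union> set Q"
    by (auto simp: R_def sets)
  define PS' where "PS' = insert R (PS - {P, Q})"
  have R_disj: "set R \<inter> set S = {}" if "S \<in> PS - {P, Q}" for S
    using that disj[OF PQ(1), of S] disj[OF PQ(2), of S] M(2) W by (auto simp: setR)
  \<comment> \<open>The new path is not already present, so the number of paths drops by exactly
    one.\<close>
  have "R \<notin> PS - {P, Q}"
    using R_disj[of R] ne by (auto simp: R_def)
  then have card: "card PS = Suc (card PS')"
    using fin PQ card_Diff_subset[of "{P, Q}" PS] card_mono[of PS "{P, Q}"]
    by (auto simp: PS'_def card_insert_if)
  have "\<exists>P\<in>PS'. \<exists>X Y. P = X @ [u, v] @ Y \<or> P = X @ [v, u] @ Y"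
  proof -
    obtain T where T: "T \<in> PS" "\<exists>X Y. T = X @ [u, v] @ Y \<or> T = X @ [v, u] @ Y"
      using cons by blast
    show ?thesis
    proof (cases "T \<in> {P, Q}")
      case True
      then have "(\<exists>X Y. P' = X @ [u, v] @ Y \<or> P' = X @ [v, u] @ Y) \<or>
          (\<exists>X Y. Q' = X @ [u, v] @ Y \<or> Q' = X @ [v, u] @ Y)"
        using T(2) consecutive_rev[OF T(2)] P'(2) Q'(2) by blast
      then show ?thesis
        unfolding PS'_def using consecutive_append[of P' u v Q' M] R_def by blast
    next
      case False
      then have "T \<in> PS'" using T(1) by (simp add: PS'_def)
      then show ?thesis using T(2) by blast
    qed
  qed
  moreover have "\<Union>(set ` PS') = W \<union> set M"
    using W PQ setR by (auto simp: PS'_def)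
  moreover have "\<forall>S\<in>PS'. \<forall>T\<in>PS'. S \<noteq> T \<longrightarrow> set S \<inter> set T = {}"
    using disj R_disj by (auto simp: PS'_def)
  moreover have "finite PS'" "\<forall>S\<in>PS'. piece S"
    using fin R pieces by (auto simp: PS'_def)
  ultimately have sys: "path_system u v PS' (W \<union> set M)"
    unfolding path_system_def by blast
  have R_ends: "hd R = hd P'" "last R = last Q'"
    using ne by (simp_all add: R_def)
  have P_ends: "{hd P, last P} = {hd P', p}" "{hd Q, last Q} = {q, last Q'}"
    using P' Q' ne by (auto simp: hd_rev last_rev)
  \<comment> \<open>By disjointness a path \<open>[p]\<close> must be \<open>P\<close> itself, so
    \<open>p\<close> is also the outer end of \<open>P'\<close> and stays an end of
    \<open>R\<close>.\<close>
  have single_P: "hd P' = p" if "p \<in> singles PS"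
  proof -
    have "[p] \<in> PS" using that by (simp add: singles_def)
    moreover have "p \<in> set P" using p ne by auto
    ultimately have "P = [p]" using disj[OF PQ(1), of "[p]"] by auto
    then show ?thesis using P' by auto
  qed
  have single_Q: "last Q' = q" if "q \<in> singles PS"
  proof -
    have "[q] \<in> PS" using that by (simp add: singles_def)
    moreover have "q \<in> set Q" using q ne by auto
    ultimately have "Q = [q]" using disj[OF PQ(2), of "[q]"] by auto
    then show ?thesis using Q' by auto
  qed
  have "ends PS - ({p, q} - singles PS) \<subseteq> ends PS'"
  proof
    fix x assume x: "x \<in> ends PS - ({p, q} - singles PS)"
    then obtain S where S: "S \<in> PS" "x \<in> {hd S, last S}"
      by (auto simp: ends_def)
    show "x \<in> ends PS'"
    proof (cases "S \<in> {P, Q}")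
      case True
      then have "x \<in> {hd P', p, q, last Q'}" using S P_ends by blast
      then have "x \<in> {hd P', last Q'}" using x single_P single_Q by auto
      then show ?thesis by (auto simp: ends_def PS'_def R_ends)
    next
      case False
      then show ?thesis using S by (auto simp: ends_def PS'_def)
    qed
  qed
  moreover have "singles PS - {p, q} \<subseteq> singles PS'"
    using p q by (auto simp: singles_def PS'_def)
  ultimately show ?thesis
    using that sys card by blast
qed

lemma ends_subset: "path_system u v PS W \<Longrightarrow> ends PS \<subseteq> C"
  by (auto simp: path_system_def ends_def piece_def)

text \<open>The first vertices of the disjoint paths are distinct; the path through \<open>u\<close>
  and \<open>v\<close> adds its last vertex, as it has at least two vertices.\<close>

lemma card_ends:
  assumes "path_system u v PS W" "u \<noteq> v"
  shows "card PS + 1 \<le> card (ends PS)"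
proof -
  have fin: "finite PS" and pieces: "\<And>R. R \<in> PS \<Longrightarrow> R \<noteq> [] \<and> distinct R"
    and disj: "\<And>R S. R \<in> PS \<Longrightarrow> S \<in> PS \<Longrightarrow> R \<noteq> S \<Longrightarrow> set R \<inter> set S = {}"
    using assms(1) unfolding path_system_def piece_def by blast+
  obtain T X Y where T: "T \<in> PS" "T = X @ [u, v] @ Y \<or> T = X @ [v, u] @ Y"
    using assms(1) unfolding path_system_def by blast
  have "hd T \<noteq> last T"
    using T pieces[OF T(1)] assms(2) by (cases X; cases Y rule: rev_cases) auto
  then have notin: "last T \<notin> hd ` PS"
    using disj[OF T(1)] pieces T(1) by (metis disjoint_iff hd_in_set imageE last_in_set)
  have "inj_on hd PS"
    using disj pieces by (metis disjoint_iff hd_in_set inj_onI)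
  then have "card PS + 1 = card (insert (last T) (hd ` PS))"
    using fin notin by (simp add: card_image)
  also have "\<dots> \<le> card (ends PS)"
    using T(1) fin by (intro card_mono) (auto simp: ends_def)
  finally show ?thesis .
qed

text \<open>While several paths remain, a clique edge joins two of them. The last path, oriented as
  \<open>X @ [v, u] @ Y\<close>, is cut between \<open>v\<close> and \<open>u\<close>, and its outer
  ends are joined by a clique edge.\<close>

lemma path_system_imp_spanning_path:
  assumes "path_system u v PS W" "u \<noteq> v"
  obtains p where "distinct p" "successively adj p" "p \<noteq> []" "hd p = u" "last p = v" "set p = W"
  using assms
proof (induction "card PS" arbitrary: PS thesis rule: less_induct)
  case less
  obtain T X Y where T: "T \<in> PS" "T = X @ [u, v] @ Y \<or> T = X @ [v, u] @ Y"
    using less.prems(2) unfolding path_system_def by blast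
  have T_piece: "piece T"
    using T(1) less.prems(2) unfolding path_system_def by blast
  show ?case
  proof (cases "PS = {T}")
    case True
    then have set_T: "set T = W"
      using less.prems(2) unfolding path_system_def by blast
    obtain X Y where XY: "T = X @ [v, u] @ Y \<or> rev T = X @ [v, u] @ Y"
    proof -
      from T(2) have "T = X @ [v, u] @ Y \<or> rev T = rev Y @ [v, u] @ rev X" by auto
      then show ?thesis using that by blast
    qed
    define S where "S = X @ [v, u] @ Y"
    have S: "piece S" "set S = W"
      using XY T_piece piece_rev[OF T_piece] set_T set_rev[of T] unfolding S_def by metis+
    have "last ([u] @ Y) = last S" "hd (X @ [v]) = hd S"
      by (auto simp: S_def hd_append)
    then have in_C: "last ([u] @ Y) \<in> C" "hd (X @ [v]) \<in> C"
      using S(1) by (auto simp: piece_def)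
    have "set ([u] @ Y) \<inter> set (X @ [v]) = {}"
      using S(1) by (auto simp: S_def piece_def)
    moreover have "last ([u] @ Y) \<in> set ([u] @ Y)" "hd (X @ [v]) \<in> set (X @ [v])"
      by (rule last_in_set, simp, rule hd_in_set, simp)
    ultimately have "adj (last ([u] @ Y)) (hd (X @ [v]))"
      using in_C by (metis adj_C disjoint_iff)
    moreover have "successively adj ([u] @ Y)" "successively adj (X @ [v])"
      using S(1) by (auto simp: S_def piece_def successively_append_iff successively_Cons)
    ultimately have *: "successively adj (([u] @ Y) @ X @ [v])"
      by (subst successively_append_iff) simp
    show ?thesis
      using less.prems(1)[of "([u] @ Y) @ X @ [v]"] * S by (auto simp: S_def piece_def)
  next
    case False
    then obtain Q where Q: "Q \<in> PS" "Q \<noteq> T"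
      using T(1) by blast
    have "piece Q" and disj: "set T \<inter> set Q = {}"
      using Q T(1) less.prems(2) unfolding path_system_def by blast+
    then have adj: "adj (last T) (hd Q)"
      using T_piece by (metis adj_C disjoint_iff hd_in_set last_in_set piece_def)
    obtain PS' where "path_system u v PS' (W \<union> set [])" "card PS = Suc (card PS')"
      by (rule path_system_merge[OF less.prems(2) T(1) Q(1) Q(2)[symmetric], of "last T" "hd Q" "[]"])
        (use adj in auto)
    then show ?thesis
      using less.hyps[of PS'] less.prems(1,3) by auto
  qed
qed

text \<open>Three vertices cannot all be ends of the same path, and two singletons are different
  paths; either way \<open>a\<close> can join two paths.\<close>

lemma path_system_extend:
  assumes PS: "path_system u v PS (C \<union> J)" and a: "a \<notin> C \<union> J"
    and S: "S \<subseteq> nbrs a \<inter> ends PS" "card S \<ge> 3 \<or> S \<subseteq> singles PS \<and> card S \<ge> 2"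
  obtains PS' p q where "path_system u v PS' (C \<union> insert a J)" "card PS = Suc (card PS')"
    "p \<in> S" "q \<in> S" "ends PS - ({p, q} - singles PS) \<subseteq> ends PS'"
    "singles PS - {p, q} \<subseteq> singles PS'"
proof -
  have "\<exists>P\<in>PS. \<exists>Q\<in>PS. P \<noteq> Q \<and> (\<exists>p\<in>S. p \<in> {hd P, last P}) \<and> (\<exists>q\<in>S. q \<in> {hd Q, last Q})"
    using S(2)
  proof
    assume card: "card S \<ge> 3"
    then obtain p where "p \<in> S" by fastforce
    then obtain P where P: "P \<in> PS" "p \<in> {hd P, last P}"
      using S(1) by (auto simp: ends_def)
    have "\<not> S \<subseteq> {hd P, last P}"
    proof
      assume "S \<subseteq> {hd P, last P}"
      then have "card S \<le> card {hd P, last P}" by (intro card_mono) auto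
      also have "\<dots> \<le> 2" by (simp add: card_insert_if)
      finally show False using card by simp
    qed
    then obtain q where q: "q \<in> S" "q \<notin> {hd P, last P}" by blast
    then obtain Q where "Q \<in> PS" "q \<in> {hd Q, last Q}"
      using S(1) by (auto simp: ends_def)
    moreover from this have "P \<noteq> Q" using q(2) by auto
    ultimately show ?thesis using P \<open>p \<in> S\<close> q(1)
      by (intro bexI[of _ P] bexI[of _ Q] conjI bexI[of _ p] bexI[of _ q])
  next
    assume S2: "S \<subseteq> singles PS \<and> card S \<ge> 2"
    then have "\<not> card S \<le> Suc 0" by simp
    moreover have "finite S" using S2 card.infinite by fastforce
    ultimately obtain p q where "p \<in> S" "q \<in> S" "p \<noteq> q"
      by (meson card_le_Suc0_iff_eq)
    moreover from this have "[p] \<in> PS" "[q] \<in> PS"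
      using S2 by (auto simp: singles_def)
    ultimately show ?thesis
      by (intro bexI[of _ "[p]"] bexI[of _ "[q]"] conjI bexI[of _ p] bexI[of _ q]) auto
  qed
  then obtain P Q p q where PQ: "P \<in> PS" "Q \<in> PS" "P \<noteq> Q" "p \<in> {hd P, last P}" "q \<in> {hd Q, last Q}"
    and pq: "p \<in> S" "q \<in> S" by blast
  have "adj a p" "adj a q"
    using pq S(1) by (auto simp: nbrs_def)
  then have "successively adj (p # [a] @ [q])"
    using adj_sym by auto
  then obtain PS' where "path_system u v PS' ((C \<union> J) \<union> set [a])" "card PS = Suc (card PS')"
    "ends PS - ({p, q} - singles PS) \<subseteq> ends PS'" "singles PS - {p, q} \<subseteq> singles PS'"
    using path_system_merge[OF PS PQ, of "[a]"] a by auto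
  with pq show ?thesis
    by (intro that[of PS' p q]) auto
qed

text \<open>Each vertex of \<open>L\<close> uses up singletons that no other one needs. As only
  singletons are used, no end is lost.\<close>

lemma path_system_extend_disjoint:
  assumes "finite L" "path_system u v PS (C \<union> J)" "L \<inter> (C \<union> J) = {}"
    "\<And>x. x \<in> L \<Longrightarrow> card (nbrs x \<inter> singles PS) \<ge> 2"
    "\<And>x y. x \<in> L \<Longrightarrow> y \<in> L \<Longrightarrow> x \<noteq> y \<Longrightarrow> nbrs x \<inter> nbrs y = {}"
  shows "\<exists>PS'. path_system u v PS' (C \<union> (J \<union> L)) \<and> card PS = card PS' + card L \<and> ends PS \<subseteq> ends PS'"
  using assms
proof (induction L arbitrary: PS J rule: finite_induct)
  case empty
  then show ?case by auto
next
  case (insert x F)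
  let ?S = "nbrs x \<inter> singles PS"
  have "?S \<subseteq> nbrs x \<inter> ends PS"
    by (force simp: singles_def ends_def)
  then obtain PS1 p q where PS1: "path_system u v PS1 (C \<union> insert x J)" "card PS = Suc (card PS1)"
    and pq: "p \<in> ?S" "q \<in> ?S"
    and ends: "ends PS - ({p, q} - singles PS) \<subseteq> ends PS1" and singles: "singles PS - {p, q} \<subseteq> singles PS1"
    using path_system_extend[OF insert.prems(1), of x ?S] insert.prems(2,3) by (metis insert_disjoint(1) insertI1 inf_le2)
  have "card (nbrs y \<inter> singles PS1) \<ge> 2" if "y \<in> F" for y
  proof -
    have "nbrs x \<inter> nbrs y = {}"
      using that insert.prems(4)[of x y] insert.hyps by auto
    then have "nbrs y \<inter> singles PS \<subseteq> nbrs y \<inter> singles PS1"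
      using pq singles by blast
    then have "card (nbrs y \<inter> singles PS) \<le> card (nbrs y \<inter> singles PS1)"
      using finite_nbrs by (intro card_mono) auto
    then show ?thesis using insert.prems(3)[of y] that by auto
  qed
  then obtain PS' where PS': "path_system u v PS' (C \<union> (insert x J \<union> F))"
    "card PS1 = card PS' + card F" "ends PS1 \<subseteq> ends PS'"
    using insert.IH[OF PS1(1)] insert.prems(2,4) insert.hyps by fastforce
  moreover have "ends PS \<subseteq> ends PS1"
    using ends pq by blast
  ultimately show ?case
    using PS1(2) insert.hyps by (intro exI[of _ PS']) auto
qed

text \<open>The number \<open>t\<close> bounds the clique vertices that are no longer ends of a path.\<close>

definition linked :: "'a \<Rightarrow> 'a \<Rightarrow> 'a set \<Rightarrow> nat \<Rightarrow> bool" where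
  "linked u v J t \<longleftrightarrow> (\<exists>PS. path_system u v PS (C \<union> J) \<and> card PS + card J + 1 = card C \<and>
    card (C - ends PS) \<le> t)"

text \<open>By \<open>card_ends\<close>, the \<open>card C - card J - 1\<close> paths have at least
  \<open>card C - card J\<close> ends.\<close>

lemma linked_card:
  assumes "linked u v J t" "u \<noteq> v"
  shows "linked u v J (card J)"
proof -
  obtain PS where PS: "path_system u v PS (C \<union> J)" "card PS + card J + 1 = card C"
    using assms by (auto simp: linked_def)
  have "card (C - ends PS) = card C - card (ends PS)"
    using ends_subset[OF PS(1)] finite_C by (simp add: card_Diff_subset finite_subset)
  then show ?thesis
    using PS card_ends[OF PS(1) assms(2)] unfolding linked_def by (intro exI[of _ PS]) auto
qed

text \<open>At most \<open>t\<close> neighbours of \<open>a\<close> are lost, so three usable ends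
  remain; joining through \<open>a\<close> loses at most two more.\<close>

lemma linked_insert:
  assumes "linked u v J t" "finite J" "a \<notin> C \<union> J" "card (nbrs a) \<ge> t + 3"
  shows "linked u v (insert a J) (t + 2)"
proof -
  obtain PS where PS: "path_system u v PS (C \<union> J)" "card PS + card J + 1 = card C"
    "card (C - ends PS) \<le> t"
    using assms(1) by (auto simp: linked_def)
  have "card (nbrs a) \<le> card ((nbrs a \<inter> ends PS) \<union> (C - ends PS))"
    using finite_C nbrs_subset finite_nbrs by (intro card_mono) auto
  also have "\<dots> \<le> card (nbrs a \<inter> ends PS) + card (C - ends PS)"
    by (rule card_Un_le)
  finally have "card (nbrs a \<inter> ends PS) \<ge> 3"
    using PS(3) assms(4) by linarith
  then obtain PS' p q where PS': "path_system u v PS' (C \<union> insert a J)" "card PS = Suc (card PS')"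
    "ends PS - ({p, q} - singles PS) \<subseteq> ends PS'"
    using path_system_extend[OF PS(1) assms(3), of "nbrs a \<inter> ends PS"] by (metis order_refl)
  have "card (C - ends PS') \<le> card ((C - ends PS) \<union> {p, q})"
    using PS'(3) finite_C by (intro card_mono) auto
  also have "\<dots> \<le> card (C - ends PS) + card {p, q}"
    by (rule card_Un_le)
  also have "\<dots> \<le> t + 2"
    using PS(3) by (simp add: card_insert_if)
  finally show ?thesis
    using PS' PS(2) assms(2,3) unfolding linked_def by (intro exI[of _ PS']) auto
qed

lemma path_system_initial:
  assumes "u \<in> C" "v \<in> C" "u \<noteq> v"
  obtains PS where "path_system u v PS C" "card PS + 1 = card C" "ends PS = C"
    "singles PS = C - {u, v}"
proof
  let ?PS = "insert [u, v] ((\<lambda>c. [c]) ` (C - {u, v}))"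
  show "path_system u v ?PS C"
    unfolding path_system_def
  proof (intro conjI)
    show "\<exists>P\<in>?PS. \<exists>X Y. P = X @ [u, v] @ Y \<or> P = X @ [v, u] @ Y"
      by (rule bexI[of _ "[u, v]"]) (auto intro: exI[of _ "[]"])
  qed (use assms finite_C in \<open>auto simp: piece_def adj_C\<close>)
  have "card ((\<lambda>c. [c]) ` (C - {u, v})) = card C - 2"
    using assms finite_C by (subst card_image) (auto simp: inj_on_def card_Diff_subset)
  moreover have "[u, v] \<notin> (\<lambda>c. [c]) ` (C - {u, v})" by auto
  moreover have "card {u, v} \<le> card C"
    using assms finite_C by (intro card_mono) auto
  ultimately show "card ?PS + 1 = card C"
    using assms finite_C by simp
  show "ends ?PS = C" "singles ?PS = C - {u, v}"
    using assms by (auto simp: ends_def singles_def)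
qed

text \<open>By disjointness at most one vertex of \<open>L\<close> is adjacent to both
  \<open>u\<close> and \<open>v\<close>. It is joined first; every other one has at least two
  singleton neighbours, and these remain.\<close>

lemma linked_disjoint:
  assumes uv: "u \<in> C" "v \<in> C" "u \<noteq> v"
    and L: "finite L" "L \<inter> C = {}" "\<And>x. x \<in> L \<Longrightarrow> card (nbrs x) \<ge> 3"
    and disj: "\<And>x y. x \<in> L \<Longrightarrow> y \<in> L \<Longrightarrow> x \<noteq> y \<Longrightarrow> nbrs x \<inter> nbrs y = {}"
  shows "linked u v L 1"
proof -
  obtain PS where PS: "path_system u v PS C" "card PS + 1 = card C" "ends PS = C"
    "singles PS = C - {u, v}"
    using path_system_initial[OF uv] by blast
  have two: "card (nbrs x \<inter> (C - {u, v})) \<ge> 2" if "x \<in> L" "\<not> {u, v} \<subseteq> nbrs x" for x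
  proof -
    have "nbrs x \<inter> {u, v} \<subseteq> {u} \<or> nbrs x \<inter> {u, v} \<subseteq> {v}"
      using that(2) by blast
    then have "card (nbrs x \<inter> {u, v}) \<le> 1"
      by (metis card.empty card_insert_disjoint card_mono empty_iff finite.emptyI finite.insertI One_nat_def)
    moreover have "nbrs x = (nbrs x \<inter> (C - {u, v})) \<union> (nbrs x \<inter> {u, v})"
      using nbrs_subset by blast
    then have "card (nbrs x) \<le> card (nbrs x \<inter> (C - {u, v})) + card (nbrs x \<inter> {u, v})"
      by (metis card_Un_le)
    ultimately show ?thesis using L(3)[OF that(1)] by linarith
  qed
  show ?thesis
  proof (cases "\<exists>x\<in>L. {u, v} \<subseteq> nbrs x")
    case True
    then obtain x where x: "x \<in> L" "{u, v} \<subseteq> nbrs x" by blast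
    have PS0: "path_system u v PS (C \<union> {})" "x \<notin> C \<union> {}"
      "nbrs x \<subseteq> nbrs x \<inter> ends PS" "card (nbrs x) \<ge> 3"
      using PS x L nbrs_subset by auto
    obtain PS1 p q where PS1: "path_system u v PS1 (C \<union> {x})" "card PS = Suc (card PS1)"
      "p \<in> nbrs x" "q \<in> nbrs x" "singles PS - {p, q} \<subseteq> singles PS1"
      by (rule path_system_extend[OF PS0(1-3)]) (use PS0(4) in auto)
    have disj_x: "nbrs y \<inter> nbrs x = {}" if "y \<in> L - {x}" for y
      using that disj x(1) by blast
    have "card (nbrs y \<inter> singles PS1) \<ge> 2" if y: "y \<in> L - {x}" for y
    proof -
      have "nbrs y \<inter> (C - {u, v}) \<subseteq> nbrs y \<inter> singles PS1"
        using disj_x[OF y] PS1(3-5) PS(4) by blast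
      then have "card (nbrs y \<inter> (C - {u, v})) \<le> card (nbrs y \<inter> singles PS1)"
        using finite_nbrs by (intro card_mono) auto
      moreover have "\<not> {u, v} \<subseteq> nbrs y"
        using disj_x[OF y] x(2) by blast
      ultimately show ?thesis using two[of y] y by auto
    qed
    note singles_PS1 = this
    obtain PS' where PS': "path_system u v PS' (C \<union> ({x} \<union> (L - {x})))"
      "card PS1 = card PS' + card (L - {x})" "ends PS1 \<subseteq> ends PS'"
    proof (atomize_elim, rule path_system_extend_disjoint[OF _ PS1(1)])
      show "finite (L - {x})" using L(1) by simp
      show "(L - {x}) \<inter> (C \<union> {x}) = {}" using L(2) by blast
      show "card (nbrs y \<inter> singles PS1) \<ge> 2" if "y \<in> L - {x}" for y
        using that by (rule singles_PS1)
      show "nbrs y \<inter> nbrs z = {}" if "y \<in> L - {x}" "z \<in> L - {x}" "y \<noteq> z" for y z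
        using that by (intro disj) auto
    qed
    have "card L = Suc (card (L - {x}))"
      using L(1) x(1) by (rule card.remove)
    moreover have "card (C - ends PS') \<le> card (C - ends PS1)"
      using PS'(3) finite_C by (intro card_mono) auto
    \<comment> \<open>One joining leaves \<open>card C - 2\<close> paths, which have at least
      \<open>card C - 1\<close> ends.\<close>
    moreover have "card (C - ends PS1) \<le> 1"
      using card_ends[OF PS1(1) uv(3)] ends_subset[OF PS1(1)] finite_C PS1(2) PS(2)
      by (simp add: card_Diff_subset finite_subset)
    moreover have "{x} \<union> (L - {x}) = L" using x(1) by blast
    ultimately show ?thesis
      using PS' PS1(2) PS(2) unfolding linked_def by (intro exI[of _ PS']) auto
  next
    case False
    have "\<exists>PS'. path_system u v PS' (C \<union> ({} \<union> L)) \<and> card PS = card PS' + card L \<and>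
        ends PS \<subseteq> ends PS'"
    proof (rule path_system_extend_disjoint[OF L(1)])
      show "card (nbrs x \<inter> singles PS) \<ge> 2" if "x \<in> L" for x
        using two[OF that] False that PS(4) by auto
      show "nbrs y \<inter> nbrs z = {}" if "y \<in> L" "z \<in> L" "y \<noteq> z" for y z
        using that by (rule disj)
    qed (use PS(1) L(2) in auto)
    then obtain PS' where "path_system u v PS' (C \<union> ({} \<union> L))"
      "card PS = card PS' + card L" "ends PS \<subseteq> ends PS'"
      by blast
    then show ?thesis
      using PS unfolding linked_def by (intro exI[of _ PS']) (auto simp: Diff_eq_empty_iff[THEN iffD2])
  qed
qed

end

section \<open>Neighbourhoods in a split graph without large stars\<close>

text \<open>These are the only consequences of 3-connectivity and star-freeness that the counting
  uses; \<open>star_free_splitI\<close> derives them.\<close>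

locale star_free_split = finite_clique adj C for adj :: "'a \<Rightarrow> 'a \<Rightarrow> bool" and C +
  fixes I :: "'a set"
  assumes finite_I: "finite I" and disjoint_IC: "I \<inter> C = {}"
    and deg_ge_3: "a \<in> I \<Longrightarrow> card (nbrs a) \<ge> 3"
    and card_I_nbrs_le: "c \<in> C \<Longrightarrow> card {a \<in> I. adj a c} \<le> 3"
    and triple_meets: "\<lbrakk>c \<in> C; d \<in> C; card {a \<in> I. adj a c} = 3\<rbrakk> \<Longrightarrow>
      card {a \<in> I. adj a c \<and> adj a d} \<ge> 2"
    and pair_dominates: "\<lbrakk>a \<in> I; b \<in> I; a \<noteq> b; nbrs a \<inter> nbrs b \<noteq> {}\<rbrakk> \<Longrightarrow>
      card (C - (nbrs a \<union> nbrs b)) \<le> 1"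
    and card_ge_13: "card C + card I \<ge> 13"
begin

definition inbrs :: "'a \<Rightarrow> 'a set" where
  "inbrs c = {a \<in> I. adj a c}"

lemma finite_inbrs: "finite (inbrs c)"
  using finite_I by (simp add: inbrs_def)

lemma card_inbrs: "c \<in> C \<Longrightarrow> card (inbrs c) \<le> 3"
  using card_I_nbrs_le by (simp add: inbrs_def)

lemma triple_inter:
  "c \<in> C \<Longrightarrow> d \<in> C \<Longrightarrow> card (inbrs c) = 3 \<Longrightarrow> card (inbrs c \<inter> inbrs d) \<ge> 2"
  using triple_meets[of c d] by (simp add: inbrs_def Collect_conj_eq[symmetric] Int_def conj_ac)

text \<open>Double counting of the edges between \<open>I\<close> and \<open>C\<close>.\<close>

lemma card_I_le:
  assumes "\<And>c. c \<in> C \<Longrightarrow> card (inbrs c) \<le> k"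
  shows "3 * card I \<le> k * card C"
proof -
  have "3 * card I = (\<Sum>a\<in>I. 3)" by simp
  also have "\<dots> \<le> (\<Sum>a\<in>I. card {c \<in> C. adj a c})"
    using deg_ge_3 unfolding nbrs_def by (intro sum_mono) auto
  also have "\<dots> = (\<Sum>c\<in>C. card {a \<in> I. adj a c})"
    using sum_multicount_gen[OF finite_I finite_C, of adj "\<lambda>c. card {a \<in> I. adj a c}"] by simp
  also have "\<dots> \<le> (\<Sum>c\<in>C. k)"
    using assms unfolding inbrs_def by (intro sum_mono) auto
  also have "\<dots> = k * card C" by simp
  finally show ?thesis .
qed

lemma card_C_ge_7: "card C \<ge> 7"
  using card_I_le[of 3] card_inbrs card_ge_13 by auto

text \<open>Inclusion-exclusion: a common neighbour makes up for the at most one vertex of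
  \<open>C\<close> that is missed.\<close>

lemma deg_add_ge:
  assumes "a \<in> I" "b \<in> I" "a \<noteq> b" "nbrs a \<inter> nbrs b \<noteq> {}"
  shows "card (nbrs a) + card (nbrs b) \<ge> card C"
proof -
  have "card (nbrs a) + card (nbrs b) = card (nbrs a \<union> nbrs b) + card (nbrs a \<inter> nbrs b)"
    using finite_nbrs finite_nbrs by (rule card_Un_Int)
  moreover have "card (nbrs a \<inter> nbrs b) > 0"
    using assms(4) finite_nbrs by (simp add: card_gt_0_iff)
  moreover have "card C = card (nbrs a \<union> nbrs b) + card (C - (nbrs a \<union> nbrs b))"
    using finite_C nbrs_subset finite_nbrs
    by (simp add: card_Diff_subset card_mono)
  ultimately show ?thesis
    using pair_dominates[OF assms] by linarith
qed

section \<open>Joining all of \<open>I\<close> for fixed clique vertices \<open>u\<close> and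
  \<open>v\<close>\<close>

context
  fixes u v
  assumes uv: "u \<in> C" "v \<in> C" "u \<noteq> v"
begin

lemma linked_disjoint_subset:
  assumes "L \<subseteq> I" "\<And>x y. x \<in> L \<Longrightarrow> y \<in> L \<Longrightarrow> x \<noteq> y \<Longrightarrow> nbrs x \<inter> nbrs y = {}"
  shows "linked u v L 1"
proof (rule linked_disjoint[OF uv])
  show "finite L" using assms(1) finite_I by (rule finite_subset)
  show "L \<inter> C = {}" using assms(1) disjoint_IC by blast
  show "card (nbrs x) \<ge> 3" if "x \<in> L" for x using that assms(1) deg_ge_3 by blast
qed (rule assms(2))

lemma linked_add:
  assumes "linked u v J t" "J \<subseteq> I" "a \<in> I - J" "card (nbrs a) \<ge> t + 3"
  shows "linked u v (insert a J) (t + 2)"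
proof (rule linked_insert[OF assms(1)])
  show "finite J" using assms(2) finite_I by (rule finite_subset)
  show "a \<notin> C \<union> J" using assms(3) disjoint_IC by blast
qed (rule assms(4))

text \<open>Recounting with \<open>linked_card\<close> after each joining charges one lost end per
  vertex instead of two.\<close>

lemma linked_add_card:
  assumes "linked u v J (card J)" "J \<subseteq> I" "a \<in> I - J" "card (nbrs a) \<ge> card J + 3"
  shows "linked u v (insert a J) (card (insert a J))"
  using linked_card[OF linked_add[OF assms] uv(3)] .

lemma linked_singleton: "a \<in> I \<Longrightarrow> linked u v {a} (card {a})"
  using linked_disjoint_subset[of "{a}"] by simp

text \<open>Here \<open>card C \<ge> 10\<close>, so an intersecting pair contains a vertex
  \<open>b\<close> of degree at least five. It is joined last, which allows the others to lose two
  ends.\<close>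

lemma linked_small:
  assumes "card I \<le> 3"
  shows "\<exists>t. linked u v I t"
proof (cases "\<exists>a\<in>I. \<exists>b\<in>I. a \<noteq> b \<and> nbrs a \<inter> nbrs b \<noteq> {}")
  case False
  then have "linked u v I 1" by (intro linked_disjoint_subset) blast+
  then show ?thesis ..
next
  case True
  then obtain a0 b0 where ab0: "a0 \<in> I" "b0 \<in> I" "a0 \<noteq> b0" "nbrs a0 \<inter> nbrs b0 \<noteq> {}" by blast
  have m: "card C \<ge> 10" using assms card_ge_13 by linarith
  have "card (nbrs a0) + card (nbrs b0) \<ge> 10"
    using deg_add_ge[OF ab0] m by linarith
  then have "card (nbrs b0) \<ge> 5 \<or> card (nbrs a0) \<ge> 5" by linarith
  then obtain a b where ab: "a \<in> I" "b \<in> I" "a \<noteq> b" "card (nbrs b) \<ge> 5"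
    using ab0 by metis
  have "card (I - {a, b}) \<le> 1"
    using ab assms finite_I by (simp add: card_Diff_subset)
  then have "card (I - {a, b}) = 0 \<or> card (I - {a, b}) = 1" by linarith
  then have "I - {a, b} = {} \<or> (\<exists>z. I - {a, b} = {z})"
    using finite_I by (auto simp: card_1_singleton_iff)
  then consider "I = {a, b}" | z where "I = {a, b, z}" "z \<notin> {a, b}"
    using ab(1,2) by blast
  then show ?thesis
  proof cases
    case 1
    have "linked u v (insert b {a}) (card (insert b {a}))"
      using ab by (intro linked_add_card linked_singleton) auto
    then show ?thesis using 1 by (auto simp: insert_commute)
  next
    case 2
    have z: "z \<in> I" using 2 by auto
    \<comment> \<open>Joining \<open>a\<close> and \<open>z\<close> one by one needs degree four for
      the second. If both degrees are smaller, their sum is below ten, so the neighbourhoods are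
      disjoint.\<close>
    have "\<exists>J t. J = {a, z} \<and> linked u v J t \<and> t + 3 \<le> card (nbrs b)"
    proof -
      consider "card (nbrs z) \<ge> 4" | "card (nbrs a) \<ge> 4" | "card (nbrs z) < 4" "card (nbrs a) < 4"
        by linarith
      then show ?thesis
      proof cases
        case 1
        have "linked u v (insert z {a}) (card (insert z {a}))"
          using ab z 1 2 by (intro linked_add_card linked_singleton) auto
        then show ?thesis using 2 ab by (intro exI[of _ "{a, z}"] exI[of _ 2]) (auto simp: insert_commute numeral_2_eq_2)
      next
        case c2: 2
        have "linked u v (insert a {z}) (card (insert a {z}))"
          using ab z c2 2 by (intro linked_add_card linked_singleton) auto
        then show ?thesis using 2 ab by (intro exI[of _ "{a, z}"] exI[of _ 2]) (auto simp: numeral_2_eq_2)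
      next
        case 3
        then have "nbrs a \<inter> nbrs z = {}"
          using deg_add_ge[of a z] ab z m 2 by fastforce
        then have "linked u v {a, z} 1"
          using ab z by (intro linked_disjoint_subset) auto
        then show ?thesis using ab by auto
      qed
    qed
    then obtain t where "linked u v {a, z} t" "t + 3 \<le> card (nbrs b)" by auto
    then have "linked u v (insert b {a, z}) (t + 2)"
      using ab z 2 by (intro linked_add) auto
    then show ?thesis using 2 by (auto simp: insert_commute)
  qed
qed

text \<open>The other vertices cost at most one end, so three of four neighbours are still usable
  when \<open>a\<close> comes last.\<close>

lemma linked_hub:
  assumes "a \<in> I" "card (nbrs a) \<ge> 4"
    and "\<And>x y. x \<in> I - {a} \<Longrightarrow> y \<in> I - {a} \<Longrightarrow> x \<noteq> y \<Longrightarrow> nbrs x \<inter> nbrs y = {}"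
  shows "\<exists>t. linked u v I t"
proof -
  have "linked u v (I - {a}) 1"
    using assms(3) by (intro linked_disjoint_subset) auto
  then have "linked u v (insert a (I - {a})) (1 + 2)"
    using assms by (intro linked_add) auto
  then show ?thesis using assms(1) by (auto simp: insert_absorb)
qed

text \<open>A clique vertex has room for only one neighbour besides \<open>p\<close> and
  \<open>q\<close>, so the other neighbourhoods are disjoint. The hubs come last and need degrees
  four and six; they are adjacent to all of \<open>C\<close>.\<close>

lemma linked_two_hubs:
  assumes "p \<in> I" "q \<in> I" "p \<noteq> q" "\<And>c. c \<in> C \<Longrightarrow> {p, q} \<subseteq> inbrs c"
  shows "\<exists>t. linked u v I t"
proof -
  have "nbrs x \<inter> nbrs y = {}" if "x \<in> I - {p, q}" "y \<in> I - {p, q}" "x \<noteq> y" for x y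
  proof (rule ccontr)
    assume "nbrs x \<inter> nbrs y \<noteq> {}"
    then obtain c where "c \<in> nbrs x" "c \<in> nbrs y" by blast
    then have c: "c \<in> C" "x \<in> inbrs c" "y \<in> inbrs c"
      using that by (auto simp: nbrs_def inbrs_def)
    then have "card {p, q, x, y} \<le> card (inbrs c)"
      using assms(4)[OF c(1)] finite_inbrs by (intro card_mono) auto
    then show False using card_inbrs[OF c(1)] assms(3) that by auto
  qed
  then have "linked u v (I - {p, q}) 1"
    by (intro linked_disjoint_subset) auto
  moreover have full: "nbrs p = C" "nbrs q = C"
    using assms(4) by (auto simp: nbrs_def inbrs_def)
  ultimately have "linked u v (insert p (I - {p, q})) (1 + 2)"
    using assms card_C_ge_7 by (intro linked_add) auto
  then have "linked u v (insert q (insert p (I - {p, q}))) (1 + 2 + 2)"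
    by (rule linked_add) (use assms card_C_ge_7 full in auto)
  moreover have "insert q (insert p (I - {p, q})) = I"
    using assms by auto
  ultimately show ?thesis by auto
qed

text \<open>Joined one by one, the second, third and fourth vertex need degrees 4, 5 and 6. Any two
  neighbourhoods cover \<open>C\<close>, which makes the degrees large enough for a suitable
  order.\<close>

lemma linked_four:
  assumes I: "I = {a, b, c, d}" and dist: "distinct [a, b, c, d]"
    and most: "\<And>e. e \<in> C \<Longrightarrow> card (I - inbrs e) \<le> 1"
  shows "\<exists>t. linked u v I t"
proof -
  have m: "card C \<ge> 9" using card_ge_13 I dist by simp
  have cover: "nbrs x \<union> nbrs y = C" if "x \<in> I" "y \<in> I" "x \<noteq> y" for x y
  proof
    show "C \<subseteq> nbrs x \<union> nbrs y"
    proof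
      fix e assume e: "e \<in> C"
      show "e \<in> nbrs x \<union> nbrs y"
      proof (rule ccontr)
        assume "e \<notin> nbrs x \<union> nbrs y"
        then have "card {x, y} \<le> card (I - inbrs e)"
          using that e finite_I by (intro card_mono) (auto simp: nbrs_def inbrs_def)
        then show False using most[OF e] that by simp
      qed
    qed
  qed (use nbrs_subset in blast)
  have pair: "card (nbrs x) + card (nbrs y) \<ge> 9" if "x \<in> I" "y \<in> I" "x \<noteq> y" for x y
    using card_Un_le[of "nbrs x" "nbrs y"] cover[OF that] m by simp
  \<comment> \<open>The covering identities bound the sum of the three degrees below by
    \<open>2 * card C\<close>, hence by 18.\<close>
  have three: "card (nbrs x) \<ge> 6 \<or> card (nbrs y) \<ge> 6 \<or> card (nbrs z) \<ge> 6"
    if "x \<in> I" "y \<in> I" "z \<in> I" "x \<noteq> y" "x \<noteq> z" "y \<noteq> z" for x y z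
  proof -
    have "nbrs x \<union> (nbrs y \<inter> nbrs z) = C"
      using cover that by blast
    then have "card C \<le> card (nbrs x) + card (nbrs y \<inter> nbrs z)"
      by (metis card_Un_le)
    moreover have "card (nbrs y) + card (nbrs z) = card C + card (nbrs y \<inter> nbrs z)"
      using card_Un_Int[OF finite_nbrs finite_nbrs, of y z] cover that by metis
    ultimately show ?thesis using m by linarith
  qed
  have order: "\<exists>t. linked u v I t"
    if "{w, x, y, z} = I" "distinct [w, x, y, z]" "card (nbrs x) \<ge> 5" "card (nbrs y) \<ge> 5"
      "card (nbrs z) \<ge> 6" for w x y z
  proof -
    have "linked u v {w} (card {w})"
      using that(1) by (intro linked_singleton) auto
    then have "linked u v (insert x {w}) (card (insert x {w}))"
      by (rule linked_add_card) (use that in auto)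
    then have "linked u v (insert y (insert x {w})) (card (insert y (insert x {w})))"
      by (rule linked_add_card) (use that in auto)
    then have "linked u v (insert z (insert y (insert x {w}))) (card (insert z (insert y (insert x {w}))))"
      by (rule linked_add_card) (use that in auto)
    then show ?thesis using that(1) by (auto simp: insert_commute)
  qed
  \<comment> \<open>Two degrees sum to at least nine, so at most one of \<open>w\<close>,
    \<open>x\<close>, \<open>y\<close> has degree below five; it goes first.\<close>
  have order3: "\<exists>t. linked u v I t"
    if *: "{w, x, y, z} = I" "distinct [w, x, y, z]" "card (nbrs z) \<ge> 6" for w x y z
  proof -
    have "card (nbrs w) + card (nbrs x) \<ge> 9" "card (nbrs w) + card (nbrs y) \<ge> 9"
      "card (nbrs x) + card (nbrs y) \<ge> 9"
      using pair * by auto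
    then consider "card (nbrs x) \<ge> 5" "card (nbrs y) \<ge> 5" | "card (nbrs w) \<ge> 5" "card (nbrs y) \<ge> 5"
      | "card (nbrs w) \<ge> 5" "card (nbrs x) \<ge> 5"
      by linarith
    moreover have "{x, w, y, z} = I" "{y, w, x, z} = I" "distinct [x, w, y, z]" "distinct [y, w, x, z]"
      using *(1,2) by (blast, blast, simp_all, blast+)
    ultimately show ?thesis
      by cases (rule order[of w x y z] order[of x w y z] order[of y w x z]; use * in blast)+
  qed
  have "card (nbrs a) \<ge> 6 \<or> card (nbrs b) \<ge> 6 \<or> card (nbrs c) \<ge> 6"
    using three[of a b c] I dist by auto
  moreover have "{b, c, d, a} = I" "{a, c, d, b} = I" "{a, b, d, c} = I"
    unfolding I by blast+
  moreover have "distinct [b, c, d, a]" "distinct [a, c, d, b]" "distinct [a, b, d, c]"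
    using dist by auto
  ultimately show ?thesis
    using order3 by metis
qed


text \<open>Every clique vertex sees two vertices of each triple \<open>inbrs c\<close>. Either two
  vertices of \<open>I\<close> are adjacent to all of \<open>C\<close>, or three such triples force
  \<open>card I = 4\<close>, with each clique vertex missing exactly one of the four.\<close>

lemma linked_triple:
  assumes "card I \<ge> 4" "c0 \<in> C" "card (inbrs c0) = 3"
  shows "\<exists>t. linked u v I t"
proof -
  have two_of_three: "x \<in> A \<and> y \<in> A \<or> x \<in> A \<and> z \<in> A \<or> y \<in> A \<and> z \<in> A"
    if "card ({x, y, z} \<inter> A) \<ge> 2" for x y z :: 'a and A
  proof (rule ccontr)
    assume "\<not> ?thesis"
    then obtain w where "{x, y, z} \<inter> A \<subseteq> {w}" by blast
    then have "card ({x, y, z} \<inter> A) \<le> card {w}" by (intro card_mono) auto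
    then show False using that by simp
  qed
  have "\<not> I \<subseteq> inbrs c0"
    using card_mono[OF finite_inbrs, of I c0] assms(1,3) by auto
  then obtain b where b: "b \<in> I" "b \<notin> inbrs c0" by blast
  have ex_nbr: "\<exists>c\<in>C. x \<in> inbrs c" if "x \<in> I" for x
  proof -
    have "nbrs x \<noteq> {}" using deg_ge_3[OF that] by auto
    then show ?thesis using that by (auto simp: nbrs_def inbrs_def)
  qed
  obtain c1 where c1: "c1 \<in> C" "b \<in> inbrs c1" using ex_nbr[OF b(1)] by blast
  \<comment> \<open>Two vertices shared with \<open>inbrs c0\<close>, together with
    \<open>b\<close>, fill the at most three places of \<open>inbrs c1\<close>.\<close>
  have K2: "card (inbrs c0 \<inter> inbrs c1) \<ge> 2"
    using triple_inter assms c1 by blast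
  have sub: "insert b (inbrs c0 \<inter> inbrs c1) \<subseteq> inbrs c1" using c1 by blast
  have card_b: "card (insert b (inbrs c0 \<inter> inbrs c1)) = Suc (card (inbrs c0 \<inter> inbrs c1))"
    using b finite_inbrs by simp
  moreover have "card (insert b (inbrs c0 \<inter> inbrs c1)) \<le> card (inbrs c1)"
    using sub finite_inbrs by (rule card_mono[rotated])
  ultimately have K: "card (inbrs c0 \<inter> inbrs c1) = 2" and card_c1: "card (inbrs c1) = 3"
    using K2 card_inbrs[OF c1(1)] by linarith+
  obtain p q where pq: "inbrs c0 \<inter> inbrs c1 = {p, q}" "p \<noteq> q"
    using K by (auto simp: card_2_iff)
  have inbrs_c1: "inbrs c1 = {b, p, q}"
    using card_subset_eq[OF finite_inbrs sub] card_b K card_c1 pq by simp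
  have "card (inbrs c0 - {p, q}) = 1"
    using assms(3) pq by (subst card_Diff_subset) auto
  then obtain r where r: "inbrs c0 - {p, q} = {r}"
    by (auto simp: card_1_singleton_iff)
  have inbrs_c0: "inbrs c0 = {p, q, r}" and r_pq: "r \<noteq> p" "r \<noteq> q"
    using r pq(1) by auto
  have b_pqr: "b \<noteq> p" "b \<noteq> q" "b \<noteq> r"
    using b(2) inbrs_c0 by auto
  show ?thesis
  proof (cases "\<forall>c\<in>C. {p, q} \<subseteq> inbrs c")
    case True
    moreover have "p \<in> I" "q \<in> I" using pq(1) by (auto simp: inbrs_def)
    ultimately show ?thesis using linked_two_hubs[of p q] pq(2) by blast
  next
    case False
    then obtain c2 where c2: "c2 \<in> C" "\<not> {p, q} \<subseteq> inbrs c2" by blast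
    have t0: "card ({p, q, r} \<inter> inbrs e) \<ge> 2" and t1: "card ({b, p, q} \<inter> inbrs e) \<ge> 2" if "e \<in> C" for e
      using triple_inter[OF assms(2) that assms(3)] triple_inter[OF c1(1) that card_c1]
      by (simp_all add: inbrs_c0 inbrs_c1)
    \<comment> \<open>As \<open>c2\<close> misses \<open>p\<close> or \<open>q\<close>, seeing two
      of \<open>{p, q, r}\<close> and two of \<open>{b, p, q}\<close> forces the other one as well
      as \<open>r\<close> and \<open>b\<close>.\<close>
    obtain w where w: "w \<in> {p, q}" "w \<in> inbrs c2" "r \<in> inbrs c2" "b \<in> inbrs c2"
      using two_of_three[OF t0[OF c2(1)]] two_of_three[OF t1[OF c2(1)]] c2(2) by blast
    have "{w, r, b} \<subseteq> inbrs c2" using w by blast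
    moreover have "card {w, r, b} = 3"
      using w(1) r_pq b_pqr by auto
    ultimately have inbrs_c2: "inbrs c2 = {w, r, b}" "card (inbrs c2) = 3"
      using card_inbrs[OF c2(1)] finite_inbrs[of c2] card_mono[of "inbrs c2" "{w, r, b}"]
        card_subset_eq[of "inbrs c2" "{w, r, b}"] by auto
    have t2: "card ({w, r, b} \<inter> inbrs e) \<ge> 2" if "e \<in> C" for e
      using triple_inter[OF c2(1) that inbrs_c2(2)] by (simp add: inbrs_c2(1))
    \<comment> \<open>A pair meeting all three triples twice would lie in each of them, but they
      share only \<open>w\<close>. So \<open>e\<close> sees three of the four vertices, and no
      further ones by \<open>card_inbrs\<close>.\<close>
    have main: "\<exists>x. inbrs e = {p, q, r, b} - {x}" if e: "e \<in> C" for e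
    proof -
      have "\<exists>x\<in>{p, q, r, b}. {p, q, r, b} - {x} \<subseteq> inbrs e"
        using two_of_three[OF t0[OF e]] two_of_three[OF t1[OF e]] two_of_three[OF t2[OF e]] w(1)
        by (elim disjE conjE insertE emptyE) auto
      then obtain x where x: "x \<in> {p, q, r, b}" "{p, q, r, b} - {x} \<subseteq> inbrs e" by blast
      have "card ({p, q, r, b} - {x}) = 3"
        using x(1) pq(2) r_pq b_pqr by (subst card_Diff_subset) auto
      then have "{p, q, r, b} - {x} = inbrs e"
        using card_inbrs[OF e] card_mono[OF finite_inbrs x(2)]
        by (intro card_subset_eq[OF finite_inbrs x(2)]) simp
      then show ?thesis by blast
    qed
    have I: "I = {p, q, r, b}"
    proof
      show "I \<subseteq> {p, q, r, b}"
        using ex_nbr main by blast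
      show "{p, q, r, b} \<subseteq> I"
        using inbrs_c0 b(1) by (auto simp: inbrs_def)
    qed
    show ?thesis
    proof (rule linked_four[OF I])
      show "distinct [p, q, r, b]" using pq(2) r_pq b_pqr by auto
      fix e assume "e \<in> C"
      then obtain x where "inbrs e = {p, q, r, b} - {x}" using main by blast
      then have "I - inbrs e \<subseteq> {x}" unfolding I by blast
      then have "card (I - inbrs e) \<le> card {x}" by (intro card_mono) auto
      then show "card (I - inbrs e) \<le> 1" by simp
    qed
  qed
qed

end

section \<open>Clique vertices with at most two independent neighbours\<close>

context
  assumes inbrs_le_2: "\<And>c. c \<in> C \<Longrightarrow> card (inbrs c) \<le> 2"
begin

text \<open>Now \<open>3 * card I \<le> 2 * card C\<close>, so
  \<open>5 * card C \<ge> 39\<close>.\<close>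

lemma card_C_ge_8: "card C \<ge> 8"
  using card_I_le[OF inbrs_le_2] card_ge_13 by linarith

lemma no_three_nbrs:
  assumes "c \<in> nbrs a" "c \<in> nbrs b" "c \<in> nbrs x" "a \<in> I" "b \<in> I" "x \<in> I"
    "a \<noteq> b" "a \<noteq> x" "b \<noteq> x"
  shows False
proof -
  have c: "c \<in> C" using assms(1) by (simp add: nbrs_def)
  have "card {a, b, x} \<le> card (inbrs c)"
    using assms finite_inbrs by (intro card_mono) (auto simp: nbrs_def inbrs_def)
  then show False using inbrs_le_2[OF c] assms by simp
qed

lemma unique_missed:
  assumes "a \<in> I" "b \<in> I" "a \<noteq> b" "nbrs a \<inter> nbrs b \<noteq> {}"
    "c \<in> C" "c \<notin> nbrs a" "c \<notin> nbrs b" "d \<in> C" "d \<notin> nbrs a" "d \<notin> nbrs b"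
  shows "c = d"
proof -
  have "card (C - (nbrs a \<union> nbrs b)) \<le> Suc 0"
    using pair_dominates[OF assms(1-4)] by simp
  then show ?thesis
    using assms(5-) finite_C by (subst (asm) card_le_Suc0_iff_eq) auto
qed

text \<open>A common neighbour of \<open>a\<close> and \<open>b\<close> has no third neighbour in
  \<open>I\<close>, so it is missed by the pair \<open>x\<close>, \<open>y\<close>, which misses at
  most one vertex.\<close>

lemma card_inter_le_1:
  assumes "{a, b, x, y} \<subseteq> I" "distinct [a, b, x, y]" "nbrs x \<inter> nbrs y \<noteq> {}"
  shows "card (nbrs a \<inter> nbrs b) \<le> 1"
proof -
  have "nbrs a \<inter> nbrs b \<subseteq> C - (nbrs x \<union> nbrs y)"
    using no_three_nbrs[of _ a b x] no_three_nbrs[of _ a b y] assms(1,2) nbrs_subset[of a] by auto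
  then have "card (nbrs a \<inter> nbrs b) \<le> card (C - (nbrs x \<union> nbrs y))"
    using finite_C by (intro card_mono) auto
  then show ?thesis
    using pair_dominates[of x y] assms by auto
qed

text \<open>Otherwise, as \<open>c\<close> is the only clique vertex missed by \<open>x\<close> and
  \<open>y\<close>, the rest of \<open>nbrs b\<close> lies in \<open>nbrs x\<close>, giving two
  common neighbours. Likewise \<open>nbrs y\<close> apart from \<open>d\<close> lies in
  \<open>nbrs a\<close>, so \<open>a\<close> and \<open>y\<close> intersect, and
  \<open>card_inter_le_1\<close> allows \<open>b\<close> and \<open>x\<close> only one.\<close>

lemma crossing_meets:
  assumes I: "{a, b, x, y} \<subseteq> I" and dist: "distinct [a, b, x, y]"
    and ab: "nbrs a \<inter> nbrs b \<noteq> {}" and xy: "nbrs x \<inter> nbrs y \<noteq> {}"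
  shows "nbrs b \<inter> nbrs y \<noteq> {}"
proof
  assume empty: "nbrs b \<inter> nbrs y = {}"
  obtain c where c: "c \<in> nbrs a" "c \<in> nbrs b" using ab by blast
  obtain d where d: "d \<in> nbrs x" "d \<in> nbrs y" using xy by blast
  have c_miss: "c \<in> C" "c \<notin> nbrs x" "c \<notin> nbrs y"
    using no_three_nbrs[OF c, of x] no_three_nbrs[OF c, of y] I dist c nbrs_subset by auto
  have d_miss: "d \<in> C" "d \<notin> nbrs a" "d \<notin> nbrs b"
    using no_three_nbrs[OF d, of a] no_three_nbrs[OF d, of b] I dist d nbrs_subset by auto
  have "nbrs b \<subseteq> insert c (nbrs b \<inter> nbrs x)"
  proof
    fix e assume e: "e \<in> nbrs b"
    then have "e \<in> C" "e \<notin> nbrs y" using empty nbrs_subset by auto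
    then have "e \<notin> nbrs x \<Longrightarrow> e = c"
      using unique_missed[of x y e c] I dist xy c_miss by simp
    then show "e \<in> insert c (nbrs b \<inter> nbrs x)" using e by blast
  qed
  then have "card (nbrs b) \<le> card (insert c (nbrs b \<inter> nbrs x))"
    using finite_nbrs by (intro card_mono) auto
  also have "\<dots> \<le> Suc (card (nbrs b \<inter> nbrs x))"
    using finite_nbrs by (simp add: card_insert_if)
  finally have bx: "card (nbrs b \<inter> nbrs x) \<ge> 2"
    using deg_ge_3[of b] I by simp
  have "nbrs y \<subseteq> insert d (nbrs a \<inter> nbrs y)"
  proof
    fix e assume e: "e \<in> nbrs y"
    then have "e \<in> C" "e \<notin> nbrs b" using empty nbrs_subset by auto
    then have "e \<notin> nbrs a \<Longrightarrow> e = d"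
      using unique_missed[of a b e d] I dist ab d_miss by simp
    then show "e \<in> insert d (nbrs a \<inter> nbrs y)" using e by blast
  qed
  moreover have "\<not> nbrs y \<subseteq> {d}"
    using deg_ge_3[of y] I card_mono[of "{d}" "nbrs y"] by auto
  ultimately have "nbrs a \<inter> nbrs y \<noteq> {}" by blast
  then have "card (nbrs b \<inter> nbrs x) \<le> 1"
    using I dist by (intro card_inter_le_1[of b x a y]) auto
  then show False using bx by simp
qed

text \<open>The four crossing intersections are nonempty, hence have at most one element each. Every
  clique vertex lies in one of them or is missed by one of the pairs, so
  \<open>card C \<le> 6\<close>.\<close>

lemma no_two_meeting_pairs:
  assumes I: "{a, b, x, y} \<subseteq> I" and dist: "distinct [a, b, x, y]"
    and ab: "nbrs a \<inter> nbrs b \<noteq> {}" and xy: "nbrs x \<inter> nbrs y \<noteq> {}"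
  shows False
proof -
  have meet: "nbrs b \<inter> nbrs y \<noteq> {}" "nbrs b \<inter> nbrs x \<noteq> {}" "nbrs a \<inter> nbrs y \<noteq> {}" "nbrs a \<inter> nbrs x \<noteq> {}"
    using crossing_meets[of a b x y] crossing_meets[of a b y x] crossing_meets[of b a x y]
      crossing_meets[of b a y x] I dist ab xy by (auto simp: Int_commute)
  have le: "card (nbrs a \<inter> nbrs x) \<le> 1" "card (nbrs a \<inter> nbrs y) \<le> 1"
    "card (nbrs b \<inter> nbrs x) \<le> 1" "card (nbrs b \<inter> nbrs y) \<le> 1"
    using card_inter_le_1[of a x b y] card_inter_le_1[of a y b x] card_inter_le_1[of b x a y]
      card_inter_le_1[of b y a x] meet I dist by auto
  have "card (C - (nbrs a \<union> nbrs b)) \<le> 1" "card (C - (nbrs x \<union> nbrs y)) \<le> 1"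
    using pair_dominates[of a b] pair_dominates[of x y] I dist ab xy by auto
  moreover have "C = (C - (nbrs a \<union> nbrs b)) \<union> ((C - (nbrs x \<union> nbrs y)) \<union> ((nbrs a \<inter> nbrs x) \<union>
      ((nbrs a \<inter> nbrs y) \<union> ((nbrs b \<inter> nbrs x) \<union> (nbrs b \<inter> nbrs y)))))"
    using nbrs_subset[of a] nbrs_subset[of b] by blast
  then have "card C \<le> card (C - (nbrs a \<union> nbrs b)) + (card (C - (nbrs x \<union> nbrs y)) +
      (card (nbrs a \<inter> nbrs x) + (card (nbrs a \<inter> nbrs y) + (card (nbrs b \<inter> nbrs x) + card (nbrs b \<inter> nbrs y)))))"
    by (smt (verit) add_left_mono card_Un_le order_trans)
  ultimately show False using le card_C_ge_8 by linarith
qed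

text \<open>A fourth vertex intersecting \<open>a\<close> or \<open>b\<close> would give two
  disjoint intersecting pairs. So its neighbours are missed by \<open>a\<close> and
  \<open>b\<close>, but at most one vertex is.\<close>

lemma no_meeting_triangle:
  assumes I: "{a, b, z} \<subseteq> I" "card I \<ge> 4" and dist: "distinct [a, b, z]"
    and "nbrs a \<inter> nbrs b \<noteq> {}" "nbrs a \<inter> nbrs z \<noteq> {}" "nbrs b \<inter> nbrs z \<noteq> {}"
  shows False
proof -
  have "\<not> I \<subseteq> {a, b, z}"
    using I(2) dist card_mono[of "{a, b, z}" I] by auto
  then obtain x where x: "x \<in> I" "x \<notin> {a, b, z}" by blast
  have "nbrs x \<inter> nbrs a = {}" "nbrs x \<inter> nbrs b = {}"
    using no_two_meeting_pairs[of x a b z] no_two_meeting_pairs[of x b a z] x I dist assms(4-6) by auto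
  then have "nbrs x \<subseteq> C - (nbrs a \<union> nbrs b)"
    using nbrs_subset[of x] by blast
  then have "card (nbrs x) \<le> card (C - (nbrs a \<union> nbrs b))"
    using finite_C by (intro card_mono) auto
  then show False
    using pair_dominates[of a b] deg_ge_3[OF x(1)] assms by auto
qed

text \<open>Take intersecting pairs as edges of a graph on \<open>I\<close>. Any two edges share a
  vertex and there is no triangle, so the edges form a star with centre \<open>h\<close>.\<close>

lemma hub_exists:
  assumes ab: "a \<in> I" "b \<in> I" "a \<noteq> b" "nbrs a \<inter> nbrs b \<noteq> {}" and "card I \<ge> 4"
  shows "\<exists>h\<in>I. \<exists>g\<in>I. h \<noteq> g \<and> nbrs h \<inter> nbrs g \<noteq> {} \<and>
    (\<forall>x\<in>I - {h}. \<forall>y\<in>I - {h}. x \<noteq> y \<longrightarrow> nbrs x \<inter> nbrs y = {})"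
proof (rule ccontr)
  assume "\<not> ?thesis"
  then have no_hub: "\<exists>x\<in>I - {h}. \<exists>y\<in>I - {h}. x \<noteq> y \<and> nbrs x \<inter> nbrs y \<noteq> {}"
    if "h \<in> I" "g \<in> I" "h \<noteq> g" "nbrs h \<inter> nbrs g \<noteq> {}" for h g
    using that by meson
  \<comment> \<open>An edge avoiding \<open>h\<close> must share a vertex with the edge
    \<open>hg\<close>, hence contains \<open>g\<close>.\<close>
  have meets_g: "\<exists>x\<in>I - {h, g}. nbrs g \<inter> nbrs x \<noteq> {}"
    if hg: "h \<in> I" "g \<in> I" "h \<noteq> g" "nbrs h \<inter> nbrs g \<noteq> {}" for h g
  proof -
    obtain x y where xy: "x \<in> I - {h}" "y \<in> I - {h}" "x \<noteq> y" "nbrs x \<inter> nbrs y \<noteq> {}"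
      using no_hub[OF hg] by blast
    have "x = g \<or> y = g"
      using no_two_meeting_pairs[of h g x y] hg xy by auto
    then show ?thesis using xy by (auto simp: Int_commute)
  qed
  obtain x where x: "x \<in> I - {a, b}" "nbrs b \<inter> nbrs x \<noteq> {}"
    using meets_g[of a b] ab by blast
  obtain z where z: "z \<in> I - {b, a}" "nbrs a \<inter> nbrs z \<noteq> {}"
    using meets_g[of b a] ab by (auto simp: Int_commute)
  show False
  \<comment> \<open>The edges \<open>ab\<close>, \<open>bx\<close>, \<open>az\<close> form a
    triangle, or \<open>bx\<close> and \<open>az\<close> are disjoint.\<close>
  proof (cases "x = z")
    case True
    then show False using no_meeting_triangle[of a b z] ab x z assms(5) by auto
  next
    case False
    then show False using no_two_meeting_pairs[of a z b x] ab x z by auto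
  qed
qed

text \<open>The hub \<open>h\<close> is joined last if its degree is at least four. Otherwise
  \<open>g\<close> is the only vertex intersecting it, has large degree, and serves as the hub
  instead.\<close>

lemma linked_no_triple:
  assumes uv: "u \<in> C" "v \<in> C" "u \<noteq> v" and "card I \<ge> 4"
  shows "\<exists>t. linked u v I t"
proof (cases "\<exists>a\<in>I. \<exists>b\<in>I. a \<noteq> b \<and> nbrs a \<inter> nbrs b \<noteq> {}")
  case False
  then have "linked u v I 1" by (intro linked_disjoint_subset[OF uv]) blast+
  then show ?thesis ..
next
  case True
  then obtain a b where "a \<in> I" "b \<in> I" "a \<noteq> b" "nbrs a \<inter> nbrs b \<noteq> {}" by blast
  from hub_exists[OF this assms(4)] obtain h g where
    hg: "h \<in> I" "g \<in> I" "h \<noteq> g" "nbrs h \<inter> nbrs g \<noteq> {}"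
    and disj: "\<And>x y. x \<in> I - {h} \<Longrightarrow> y \<in> I - {h} \<Longrightarrow> x \<noteq> y \<Longrightarrow> nbrs x \<inter> nbrs y = {}"
    by meson
  show ?thesis
  proof (cases "card (nbrs h) \<ge> 4")
    case True
    then show ?thesis using linked_hub[OF uv hg(1)] disj by blast
  next
    case False
    have large: "card (nbrs x) + 3 \<ge> card C" if "x \<in> I" "x \<noteq> h" "nbrs h \<inter> nbrs x \<noteq> {}" for x
      using deg_add_ge[of h x] hg(1) that False by auto
    \<comment> \<open>Otherwise \<open>g\<close> and \<open>z\<close> have disjoint neighbourhoods
      of size at least \<open>card C - 3\<close>, so \<open>card C \<le> 6\<close>.\<close>
    have h_only: "nbrs h \<inter> nbrs z = {}" if z: "z \<in> I" "z \<noteq> g" "z \<noteq> h" for z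
    proof (rule ccontr)
      assume "nbrs h \<inter> nbrs z \<noteq> {}"
      then have "card (nbrs z) + 3 \<ge> card C" "card (nbrs g) + 3 \<ge> card C"
        using large z hg by auto
      moreover have "card (nbrs g) + card (nbrs z) = card (nbrs g \<union> nbrs z)"
        using disj[of g z] z hg finite_nbrs by (subst card_Un_disjoint) auto
      moreover have "card (nbrs g \<union> nbrs z) \<le> card C"
        using finite_C nbrs_subset by (intro card_mono) auto
      ultimately show False using card_C_ge_8 by linarith
    qed
    have "card (nbrs g) \<ge> 4" using large[of g] hg card_C_ge_8 by auto
    moreover have "nbrs x \<inter> nbrs y = {}" if "x \<in> I - {g}" "y \<in> I - {g}" "x \<noteq> y" for x y
      using that disj[of x y] h_only[of x] h_only[of y] by (cases "x = h"; cases "y = h") auto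
    ultimately show ?thesis using linked_hub[OF uv hg(2)] by blast
  qed
qed

end

lemma linked_all:
  assumes "u \<in> C" "v \<in> C" "u \<noteq> v"
  shows "\<exists>t. linked u v I t"
proof (cases "card I \<le> 3")
  case True
  then show ?thesis using linked_small[OF assms] by blast
next
  case False
  show ?thesis
  proof (cases "\<exists>c\<in>C. card (inbrs c) = 3")
    case True
    then show ?thesis using linked_triple[OF assms] False by auto
  next
    case no_triple: False
    have "card (inbrs c) \<le> 2" if "c \<in> C" for c
    proof -
      have "card (inbrs c) \<noteq> 3" using no_triple that by blast
      then show ?thesis using card_inbrs[OF that] by linarith
    qed
    then show ?thesis using linked_no_triple[OF _ assms] False by simp
  qed
qed

lemma spanning_path_between_clique:
  assumes "u \<in> C" "v \<in> C" "u \<noteq> v"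
  obtains p where "distinct p" "successively adj p" "p \<noteq> []" "hd p = u" "last p = v" "set p = C \<union> I"
proof -
  obtain PS where "path_system u v PS (C \<union> I)"
    using linked_all[OF assms] unfolding linked_def by auto
  then show ?thesis
    using assms(3) that by (rule path_system_imp_spanning_path)
qed

end

section \<open>From clique ends to arbitrary ends\<close>

context star_free_split
begin

text \<open>The ends lie in \<open>C\<close>, so \<open>a\<close> is inner, and its two neighbours
  on the path are adjacent clique vertices.\<close>

lemma remove_inner_vertex:
  assumes "distinct p" "successively adj p" "p \<noteq> []" "hd p \<in> C" "last p \<in> C"
    and a: "a \<in> I" "\<And>x. x \<in> set p \<Longrightarrow> adj a x \<Longrightarrow> x \<in> C"
  shows "\<exists>q. distinct q \<and> successively adj q \<and> q \<noteq> [] \<and> hd q = hd p \<and> last q = last p \<and>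
    set q = set p - {a}"
proof (cases "a \<in> set p")
  case False
  then show ?thesis using assms(1-3) by (intro exI[of _ p]) auto
next
  case True
  then obtain X Y where p: "p = X @ a # Y" by (meson split_list)
  have "a \<notin> C" using a(1) disjoint_IC by blast
  then have ne: "X \<noteq> []" "Y \<noteq> []"
    using assms(4,5) p by auto
  have succ: "successively adj X" "adj (last X) a" "adj a (hd Y)" "successively adj Y"
    using assms(2) ne by (auto simp: p successively_append_iff successively_Cons)
  have "last X \<in> C" "hd Y \<in> C"
    using a(2) succ(2,3) ne p adj_sym by auto
  moreover have "last X \<noteq> hd Y"
    using assms(1) ne unfolding p by (metis IntI append_Cons disjoint_insert(1) distinct_append
        empty_iff hd_in_set last_in_set list.set_intros(2))
  ultimately have "successively adj (X @ Y)"
    using adj_C succ ne by (auto simp: successively_append_iff)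
  then show ?thesis
    using assms(1) ne by (intro exI[of _ "X @ Y"]) (auto simp: p)
qed

lemma spanning_path:
  assumes indep: "\<And>a b. a \<in> I \<Longrightarrow> b \<in> I \<Longrightarrow> \<not> adj a b"
    and uv: "u \<in> C \<union> I" "v \<in> C \<union> I" "u \<noteq> v"
  obtains p where "distinct p" "successively adj p" "p \<noteq> []" "hd p = u" "last p = v" "set p = C \<union> I"
proof -
  have other_nbr: "\<exists>c\<in>C. adj a c \<and> c \<noteq> x" if "a \<in> I" for a x
  proof -
    have "\<not> nbrs a \<subseteq> {x}"
      using deg_ge_3[OF that] card_mono[of "{x}" "nbrs a"] by auto
    then show ?thesis by (auto simp: nbrs_def)
  qed
  \<comment> \<open>Avoiding \<open>u\<close> here leaves \<open>u' = u\<close> possible when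
    \<open>u\<close> is in \<open>C\<close>.\<close>
  obtain v' where v': "v' \<in> C" "v' \<noteq> u" "v \<in> C \<and> v = v' \<or> v \<in> I \<and> adj v v'"
    using uv other_nbr[of v u] by blast
  obtain u' where u': "u' \<in> C" "u' \<noteq> v'" "u \<in> C \<and> u = u' \<or> u \<in> I \<and> adj u u'"
    using uv v' other_nbr[of u v'] by blast
  obtain p where p: "distinct p" "successively adj p" "p \<noteq> []" "hd p = u'" "last p = v'"
    "set p = C \<union> I"
    using spanning_path_between_clique[OF u'(1) v'(1) u'(2)] by blast
  \<comment> \<open>The set \<open>{a} \<inter> I\<close> is empty for \<open>a\<close> in
    \<open>C\<close>, so clique ends stay on the path.\<close>
  have remove: "\<exists>q. distinct q \<and> successively adj q \<and> q \<noteq> [] \<and> hd q = u' \<and> last q = v' \<and>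
      set q = set p - ({a} \<inter> I)"
    if "distinct p" "successively adj p" "p \<noteq> []" "hd p = u'" "last p = v'" "set p \<subseteq> C \<union> I" for p a
  proof (cases "a \<in> I")
    case True
    then show ?thesis
      using remove_inner_vertex[of p a] that u'(1) v'(1) indep by auto
  next
    case False
    then show ?thesis using that by (intro exI[of _ p]) auto
  qed
  obtain q where q: "distinct q" "successively adj q" "q \<noteq> []" "hd q = u'" "last q = v'"
    "set q = set p - ({u} \<inter> I)"
    using remove[of p u] p by auto
  obtain r where r: "distinct r" "successively adj r" "r \<noteq> []" "hd r = u'" "last r = v'"
    "set r = set q - ({v} \<inter> I)"
    using remove[of q v] q p(6) by auto
  have set_r: "set r = (C \<union> I) - ({u, v} \<inter> I)"
    using r(6) q(6) p(6) by auto
  define s where "s = (if u \<in> I then [u] else []) @ r @ (if v \<in> I then [v] else [])"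
  have C_not_I: "x \<notin> I" if "x \<in> C" for x
    using that disjoint_IC by blast
  show ?thesis
  proof
    show "distinct s" "set s = C \<union> I"
      using r(1) set_r uv by (auto simp: s_def)
    show "successively adj s"
      using r u'(3) v'(3) C_not_I adj_sym
      by (auto simp: s_def successively_append_iff successively_Cons)
    show "s \<noteq> []" "hd s = u" "last s = v"
      using r(3-5) u'(3) v'(3) C_not_I by (auto simp: s_def)
  qed
qed

end

section \<open>Translation to graphs\<close>

text \<open>The image of \<open>\<phi>\<close> induces a subgraph, and the inverse of
  \<open>\<phi>\<close>, applied to both ends of each arc, is an isomorphism onto
  \<open>F\<close>.\<close>

lemma induced_free_no_copy:
  assumes "induced_free \<F> G" "F \<in> \<F>" "pair_wf_digraph G" "pair_wf_digraph F"
    and inj: "inj_on \<phi> (pverts F)" and ran: "\<phi> ` pverts F \<subseteq> pverts G"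
    and arcs: "\<And>i j. i \<in> pverts F \<Longrightarrow> j \<in> pverts F \<Longrightarrow>
      (\<phi> i, \<phi> j) \<in> parcs G \<longleftrightarrow> (i, j) \<in> parcs F"
  shows False
proof -
  interpret G: pair_wf_digraph G by fact
  interpret F: pair_wf_digraph F by fact
  define V where "V = \<phi> ` pverts F"
  define H :: "('b, 'b \<times> 'b) pre_digraph" where
    "H = \<lparr>verts = V, arcs = {e \<in> parcs G. fst e \<in> V \<and> snd e \<in> V}, tail = fst, head = snd\<rparr>"
  define g where "g = the_inv_into (pverts F) \<phi>"
  define f :: "('b, 'b \<times> 'b, 'a, 'a \<times> 'a) digraph_isomorphism" where
    "f = \<lparr>iso_verts = g, iso_arcs = map_prod g g, iso_head = snd, iso_tail = fst\<rparr>"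
  have g: "g (\<phi> i) = i" if "i \<in> pverts F" for i
    using the_inv_into_f_f[OF inj that] by (simp add: g_def)
  have wf_H: "wf_digraph H"
    by unfold_locales (auto simp: H_def)
  have "induced_subgraph H (with_proj G)"
    using wf_H G.wf_digraph ran
    by (auto simp: induced_subgraph_def subgraph_def compatible_def H_def V_def)
  moreover have "pre_digraph.digraph_isomorphism H f"
    unfolding pre_digraph.digraph_isomorphism_def
  proof (intro conjI wf_H ballI)
    show "inj_on (iso_verts f) (verts H)"
      by (auto simp: f_def H_def V_def g inj_on_def)
    show "inj_on (iso_arcs f) (arcs H)"
      by (auto simp: f_def H_def V_def g inj_on_def)
  qed (auto simp: f_def H_def)
  moreover have "with_proj F = app_iso f H"
  proof -
    have "g ` V = pverts F"
      by (force simp: V_def g image_image)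
    moreover have "map_prod g g ` {e \<in> parcs G. fst e \<in> V \<and> snd e \<in> V} = parcs F"
    proof
      show "map_prod g g ` {e \<in> parcs G. fst e \<in> V \<and> snd e \<in> V} \<subseteq> parcs F"
        using arcs by (auto simp: V_def g)
      show "parcs F \<subseteq> map_prod g g ` {e \<in> parcs G. fst e \<in> V \<and> snd e \<in> V}"
      proof
        fix e assume "e \<in> parcs F"
        then obtain i j where e: "e = (i, j)" "(i, j) \<in> parcs F" by (cases e) auto
        then have ij: "i \<in> pverts F" "j \<in> pverts F" using F.wellformed' by auto
        have "e = map_prod g g (\<phi> i, \<phi> j)" using e(1) g ij by simp
        moreover have "(\<phi> i, \<phi> j) \<in> {e \<in> parcs G. fst e \<in> V \<and> snd e \<in> V}"
          using arcs[OF ij] e(2) ij by (auto simp: V_def)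
        ultimately show "e \<in> map_prod g g ` {e \<in> parcs G. fst e \<in> V \<and> snd e \<in> V}"
          by blast
      qed
    qed
    ultimately show ?thesis
      by (simp add: with_proj_def app_iso_def f_def H_def)
  qed
  ultimately show False
    using assms(1,2) unfolding induced_free_def digraph_iso_def by blast
qed

lemma pair_wf_K14: "pair_wf_digraph K14" "pair_wf_digraph K14_plus_e"
  by (unfold_locales, auto simp: K14_def K14_plus_e_def)

text \<open>The adjacency of \<open>x1\<close> and \<open>x2\<close> is left open; it decides which
  of the two forbidden graphs occurs.\<close>

lemma induced_free_star:
  assumes free: "induced_free {K14, K14_plus_e} G" and G: "pair_graph G"
    and dist: "distinct [c, x1, x2, x3, x4]"
    and center: "(c, x1) \<in> parcs G" "(c, x2) \<in> parcs G" "(c, x3) \<in> parcs G" "(c, x4) \<in> parcs G"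
    and leaves: "(x1, x3) \<notin> parcs G" "(x1, x4) \<notin> parcs G" "(x2, x3) \<notin> parcs G"
      "(x2, x4) \<notin> parcs G" "(x3, x4) \<notin> parcs G"
  shows False
proof -
  interpret pair_graph G by fact
  have sym: "(x, y) \<in> parcs G \<longleftrightarrow> (y, x) \<in> parcs G" for x y
    using pair_sym_arcs by (auto simp: symmetric_def sym_def)
  have irr: "(x, x) \<notin> parcs G" for x
    using pair_no_loops by fastforce
  define \<phi> where "\<phi> = (\<lambda>i::nat. [c, x1, x2, x3, x4] ! i)"
  define F where "F = (if (x1, x2) \<in> parcs G then K14_plus_e else K14)"
  have verts: "pverts F = {0, 1, 2, 3, 4}"
    by (simp add: F_def K14_plus_e_def K14_def)
  have \<phi>: "\<phi> 0 = c" "\<phi> 1 = x1" "\<phi> 2 = x2" "\<phi> 3 = x3" "\<phi> 4 = x4" "\<phi> (Suc 0) = x1"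
    by (simp_all add: \<phi>_def)
  show False
  proof (rule induced_free_no_copy[OF free])
    show "F \<in> {K14, K14_plus_e}" by (simp add: F_def)
    show "pair_wf_digraph G" by unfold_locales
    show "pair_wf_digraph F" using pair_wf_K14 by (simp add: F_def)
    show "inj_on \<phi> (pverts F)"
      using dist by (auto simp: verts \<phi> inj_on_def)
    show "\<phi> ` pverts F \<subseteq> pverts G"
      using center wellformed' by (auto simp: verts \<phi>)
    have sym': "(x, c) \<in> parcs G" if "(c, x) \<in> parcs G" for x using that sym by blast
    have nsym: "(x3, x1) \<notin> parcs G" "(x4, x1) \<notin> parcs G" "(x3, x2) \<notin> parcs G"
      "(x4, x2) \<notin> parcs G" "(x4, x3) \<notin> parcs G"
      using leaves sym by blast+
    have x21: "(x2, x1) \<in> parcs G \<longleftrightarrow> (x1, x2) \<in> parcs G" using sym by blast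
    show "(\<phi> i, \<phi> j) \<in> parcs G \<longleftrightarrow> (i, j) \<in> parcs F" if "i \<in> pverts F" "j \<in> pverts F" for i j
      using that[unfolded verts] unfolding F_def
      by (elim insertE emptyE)
        (simp_all add: \<phi> K14_def K14_plus_e_def center center[THEN sym'] leaves nsym irr x21)
  qed
qed

text \<open>Deleting fewer than \<open>k\<close> neighbours would isolate \<open>a\<close>, while
  another vertex survives because there are more than \<open>k\<close> vertices.\<close>

lemma k_connected_imp_card_nbrs_ge:
  assumes "pair_graph G" "k_connected k G" "a \<in> pverts G"
  shows "card {c \<in> pverts G. (a, c) \<in> parcs G} \<ge> k"
proof (rule ccontr)
  interpret pair_graph G by fact
  let ?N = "{c \<in> pverts G. (a, c) \<in> parcs G}"
  assume "\<not> ?thesis"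
  then have lt: "card ?N < k" by simp
  \<comment> \<open>Connectedness of a digraph is defined as strong connectedness of this symmetric
    closure.\<close>
  let ?H = "mk_symmetric (with_proj G \<restriction> (pverts G - ?N))"
  have "\<And>S. S \<subseteq> pverts G \<Longrightarrow> card S < k \<Longrightarrow>
      Digraph_Component.connected (with_proj G \<restriction> (pverts G - S))"
    using assms(2) by (simp add: k_connected_def)
  from this[OF _ lt] have conn: "strongly_connected (with_proj ?H)"
    unfolding connected_def by simp
  have irr: "(a, a) \<notin> parcs G" using pair_no_loops by fastforce
  have "\<not> pverts G \<subseteq> insert a ?N"
  proof
    assume "pverts G \<subseteq> insert a ?N"
    then have "card (pverts G) \<le> card (insert a ?N)"
      using pair_finite_verts by (intro card_mono) auto
    also have "\<dots> \<le> Suc (card ?N)"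
      using pair_finite_verts by (simp add: card_insert_if)
    finally show False using lt assms(2) by (simp add: k_connected_def)
  qed
  then obtain w where w: "w \<in> pverts G" "w \<noteq> a" "w \<notin> ?N" by blast
  have verts: "pverts ?H = pverts G - ?N"
    by (simp add: mk_symmetric_def)
  have "a \<rightarrow>\<^sup>*\<^bsub>with_proj ?H\<^esub> w"
    using conn w assms(3) irr unfolding strongly_connected_def by (auto simp: verts)
  then have "(a, w) \<in> rtrancl_on (pverts ?H) (parcs ?H)"
    by (simp add: reachable_def)
  then obtain y where "(a, y) \<in> parcs ?H"
    using w(2) by (cases rule: converse_rtrancl_on_cases) auto
  then have "y \<in> pverts G - ?N" "(a, y) \<in> parcs G \<or> (y, a) \<in> parcs G"
    by (auto simp: mk_symmetric_def)
  moreover from this have "(a, y) \<in> parcs G"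
    using pair_sym_arcs by (auto simp: symmetric_def sym_def)
  ultimately show False by blast
qed

lemma apath_of_list:
  assumes "p \<noteq> []" "distinct p" "successively (\<lambda>x y. (x, y) \<in> parcs G) p" "set p \<subseteq> pverts G"
  shows "pre_digraph.apath (with_proj G) (hd p) (vwalk_arcs p) (last p)"
    and "pre_digraph.awalk_verts (with_proj G) (hd p) (vwalk_arcs p) = p"
proof -
  have *: "pcas (hd p) (vwalk_arcs p) (last p) \<and> set (vwalk_arcs p) \<subseteq> parcs G \<and>
      pawalk_verts (hd p) (vwalk_arcs p) = p"
    using assms(1,3) by (induction p rule: vwalk_arcs.induct) auto
  then show "pre_digraph.awalk_verts (with_proj G) (hd p) (vwalk_arcs p) = p"
    by (simp add: awalk_verts_with_proj_eq)
  then show "pre_digraph.apath (with_proj G) (hd p) (vwalk_arcs p) (last p)"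
    using * assms(1,2,4) hd_in_set[OF assms(1)]
    by (auto simp: pre_digraph.apath_def pre_digraph.awalk_def cas_with_proj_eq)
qed

lemma star_free_splitI:
  fixes G :: "'a pair_pre_digraph"
  assumes G: "pair_graph G" and conn: "k_connected 3 G" and card: "card (pverts G) \<ge> 13"
    and free: "induced_free {K14, K14_plus_e} G"
    and CI: "pverts G = C \<union> I" "C \<inter> I = {}" "clique G C" "independent_set G I"
  shows "star_free_split (\<lambda>x y. (x, y) \<in> parcs G) C I"
proof -
  interpret pair_graph G by fact
  define adj where "adj = (\<lambda>x y. (x, y) \<in> parcs G)"
  have fin: "finite C" "finite I"
    using pair_finite_verts CI(1) by auto
  have sym: "adj x y \<Longrightarrow> adj y x" for x y
    using pair_sym_arcs by (auto simp: adj_def symmetric_def sym_def)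
  have irr: "\<not> adj x x" for x
    using pair_no_loops by (fastforce simp: adj_def)
  have adj_C: "adj x y" if "x \<in> C" "y \<in> C" "x \<noteq> y" for x y
    using CI(3) that by (auto simp: clique_def adj_def)
  have indep: "\<not> adj x y" if "x \<in> I" "y \<in> I" for x y
    using CI(4) that by (auto simp: independent_set_def adj_def)
  have star: False
    if "distinct [c, x1, x2, x3, x4]" "adj c x1" "adj c x2" "adj c x3" "adj c x4"
      "\<not> adj x1 x3" "\<not> adj x1 x4" "\<not> adj x2 x3" "\<not> adj x2 x4" "\<not> adj x3 x4" for c x1 x2 x3 x4
    using induced_free_star[OF free G that(1)] that(2-) by (simp add: adj_def)
  have ne: "x \<noteq> y" if "x \<in> C" "y \<in> I" for x y
    using that CI(2) by blast
  interpret fc: finite_clique adj C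
    using fin sym adj_C by unfold_locales auto
  have "star_free_split adj C I"
  proof unfold_locales
    show "finite I" "I \<inter> C = {}" using fin CI(2) by auto
    show "card C + card I \<ge> 13"
      using card CI(1,2) fin by (simp add: card_Un_disjoint)
    show "card (fc.nbrs a) \<ge> 3" if a: "a \<in> I" for a
    proof -
      have "{c \<in> pverts G. (a, c) \<in> parcs G} = {c \<in> pverts G. adj a c}"
        by (simp add: adj_def)
      also have "\<dots> = fc.nbrs a"
        using indep[OF a] CI(1) by (auto simp: fc.nbrs_def)
      finally have "{c \<in> pverts G. (a, c) \<in> parcs G} = fc.nbrs a" .
      then show ?thesis
        using k_connected_imp_card_nbrs_ge[OF G conn, of a] a CI(1) by simp
    qed
    show "card {a \<in> I. adj a c} \<le> 3" if c: "c \<in> C" for c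
    proof (rule ccontr)
      assume "\<not> ?thesis"
      then obtain S where S: "S \<subseteq> {a \<in> I. adj a c}" "card S = 4"
        using obtain_subset_with_card_n[of 4 "{a \<in> I. adj a c}"] by auto
      then obtain x1 x2 x3 x4 where "S = {x1, x2, x3, x4}" "distinct [x1, x2, x3, x4]"
        by (auto simp: numeral_eq_Suc card_Suc_eq)
      then show False
        using star[of c x1 x2 x3 x4] S(1) c ne sym indep by auto
    qed
    show "card {a \<in> I. adj a c \<and> adj a d} \<ge> 2"
      if c: "c \<in> C" and d: "d \<in> C" and three: "card {a \<in> I. adj a c} = 3" for c d
    proof -
      obtain x y z where xyz: "{a \<in> I. adj a c} = {x, y, z}" "x \<noteq> y" "x \<noteq> z" "y \<noteq> z"
        using three by (auto simp: card_3_iff)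
      then have I: "x \<in> I" "y \<in> I" "z \<in> I" and adj_c: "adj c x" "adj c y" "adj c z"
        using sym by blast+
      show ?thesis
      proof (cases "d = c")
        case True
        then show ?thesis using three by simp
      next
        case False
        have pair: "card {a \<in> I. adj a c \<and> adj a d} \<ge> 2"
          if "s \<noteq> t" "s \<in> {x, y, z}" "t \<in> {x, y, z}" "adj s d" "adj t d" for s t
        proof -
          have "{s, t} \<subseteq> {a \<in> I. adj a c \<and> adj a d}"
            using that xyz(1) by blast
          then have "card {s, t} \<le> card {a \<in> I. adj a c \<and> adj a d}"
            using fin by (intro card_mono) auto
          then show ?thesis using that(1) by simp
        qed
        \<comment> \<open>If \<open>d\<close> were nonadjacent to two of the three, \<open>c\<close>
          would be the centre of a forbidden star with leaves \<open>d\<close> and all three,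
          whether or not \<open>d\<close> sees the third.\<close>
        have "adj d x \<or> adj d y" "adj d x \<or> adj d z" "adj d y \<or> adj d z"
          using star[of c d z x y] star[of c d y x z] star[of c d x y z] adj_C[OF c d] False
            adj_c xyz(2-4) I indep ne c d sym by auto
        then show ?thesis
          using pair[of x y] pair[of x z] pair[of y z] xyz(2-4) sym by blast
      qed
    qed
    show "card (C - (fc.nbrs a \<union> fc.nbrs b)) \<le> 1"
      if ab: "a \<in> I" "b \<in> I" "a \<noteq> b" "fc.nbrs a \<inter> fc.nbrs b \<noteq> {}" for a b
    proof -
      obtain c where c: "c \<in> C" "adj c a" "adj c b"
        using ab(4) sym by (auto simp: fc.nbrs_def)
      \<comment> \<open>Two missed clique vertices \<open>d\<close>, \<open>e\<close> are adjacent
        and form with \<open>a\<close>, \<open>b\<close> the leaves of a copy of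
        \<open>K14_plus_e\<close> around \<open>c\<close>.\<close>
      have "d = e" if de: "d \<in> C - (fc.nbrs a \<union> fc.nbrs b)" "e \<in> C - (fc.nbrs a \<union> fc.nbrs b)" for d e
      proof (rule ccontr)
        assume "d \<noteq> e"
        have n: "d \<in> C" "e \<in> C" "\<not> adj d a" "\<not> adj d b" "\<not> adj e a" "\<not> adj e b"
          using de sym by (auto simp: fc.nbrs_def)
        moreover from this c have "c \<noteq> d" "c \<noteq> e" by auto
        ultimately show False
          using star[of c d e a b] c ab \<open>d \<noteq> e\<close> adj_C ne indep by auto
      qed
      then show ?thesis
        using fin by (simp add: card_le_Suc0_iff_eq)
    qed
  qed
  then show ?thesis by (simp add: adj_def)
qed

theorem theorem1p8:
  fixes G :: "'a pair_pre_digraph"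
  assumes "pair_graph G"
    and "k_connected 3 G"
    and "split_graph G"
    and "card (pverts G) \<ge> 13"
    and "induced_free {K14, K14_plus_e} G"
  shows "hamilton_connected G"
  unfolding hamilton_connected_def
proof (intro ballI impI)
  fix u v assume uv: "u \<in> pverts G" "v \<in> pverts G" "u \<noteq> v"
  obtain C I where CI: "pverts G = C \<union> I" "C \<inter> I = {}" "clique G C" "independent_set G I"
    using assms(3) unfolding split_graph_def by blast
  interpret star_free_split "\<lambda>x y. (x, y) \<in> parcs G" C I
    using star_free_splitI[OF assms(1,2,4,5) CI] .
  obtain p where p: "distinct p" "successively (\<lambda>x y. (x, y) \<in> parcs G) p" "p \<noteq> []"
    "hd p = u" "last p = v" "set p = C \<union> I"
    using spanning_path[of u v] CI(1,4) uv unfolding independent_set_def by auto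
  then show "\<exists>p. pre_digraph.apath (with_proj G) u p v \<and>
      set (pre_digraph.awalk_verts (with_proj G) u p) = pverts G"
    using apath_of_list[of p G] CI(1) by (intro exI[of _ "vwalk_arcs p"]) auto
qed

end
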